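(* Let $n\ge3$, and let $\mathbf{X}_1,\dots,\mathbf{X}_p$ be independent $n$-dimensional random vectors with a common spherical distribution satisfying $P(\mathbf{X}_1=\mathbf{0})=0$. Let $\rho_{ij}$ be the Pearson correlation coefficient of $\mathbf{X}_i$ and $\mathbf{X}_j$, and let $\tilde\rho_{ij}=\frac{\mathbf{X}_i^T\mathbf{X}_j}{\|\mathbf{X}_i\|\cdot\|\mathbf{X}_j\|}$. Then the random variables $\{\rho_{ij};\,1\le i<j\le p\}$ are pairwise independent and identically distributed with density function $$f(\rho)=\frac{1}{\sqrt\pi}\frac{\Gamma(\frac{n-1}{2})}{\Gamma(\frac{n-2}{2})}\cdot(1-\rho^2)^{\frac{n-4}{2}},\qquad|\rho|<1.$$ Similarly, the random variables $\{\tilde\rho_{ij};\,1\le i<j\le p\}$ are pairwise independent and identically distributed with density function $$g(\rho)=\frac{1}{\sqrt\pi}\frac{\Gamma(\frac{n}{2})}{\Gamma(\frac{n-1}{2})}\cdot(1-\rho^2)^{\frac{n-3}{2}},\qquad|\rho|<1.$$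
   Context: A random vector $\mathbf{Y}\in\mathbb{R}^n$ has a spherical distribution if $\mathbf{O}\mathbf{Y}$ and $\mathbf{Y}$ have the same probability distribution for every $n\times n$ orthogonal matrix $\mathbf{O}$. $\|\cdot\|$ is the Euclidean norm. For $\mathbf{x}=(x_1,\dots,x_n)^T$, $\mathbf{y}=(y_1,\dots,y_n)^T\in\mathbb{R}^n$, the Pearson correlation coefficient is $$\rho_{\mathbf{x},\mathbf{y}}=\frac{\sum_{i=1}^n(x_i-\bar x)(y_i-\bar y)}{\sqrt{\sum_{i=1}^n(x_i-\bar x)^2\cdot\sum_{i=1}^n(y_i-\bar y)^2}},\qquad \bar x=\frac1n\sum_{i=1}^n x_i,\quad \bar y=\frac1n\sum_{i=1}^n y_i,$$ and $\rho_{ij}=\rho_{\mathbf{X}_i,\mathbf{X}_j}$ (almost surely well defined). Pairwise independent means that any two of the variables with distinct index pairs $(i,j)\neq(k,l)$ are independent. *)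

theory Defs
  imports "HOL-Probability.Probability"
begin

definition spherical :: "'w measure \<Rightarrow> ('w \<Rightarrow> real ^ 'n) \<Rightarrow> bool" where
  "spherical M Y \<longleftrightarrow>
     Y \<in> borel_measurable M \<and>
     (\<forall>Q. orthogonal_matrix Q \<longrightarrow> distr M borel (\<lambda>\<omega>. Q *v Y \<omega>) = distr M borel Y)"

definition coord_mean :: "real ^ 'n \<Rightarrow> real" where
  "coord_mean x = (1 / real CARD('n)) * (\<Sum>i\<in>UNIV. x $ i)"

(* Takes the value 0 (division by zero) when x or y has all coordinates equal. *)
definition pearson :: "real ^ 'n \<Rightarrow> real ^ 'n \<Rightarrow> real" where
  "pearson x y =
     (\<Sum>i\<in>UNIV. (x $ i - coord_mean x) * (y $ i - coord_mean y)) /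
     sqrt ((\<Sum>i\<in>UNIV. (x $ i - coord_mean x)\<^sup>2) * (\<Sum>i\<in>UNIV. (y $ i - coord_mean y)\<^sup>2))"

(* The uncentred coefficient; takes the value 0 when x = 0 or y = 0. *)
definition pearson_uncentred :: "real ^ 'n \<Rightarrow> real ^ 'n \<Rightarrow> real" where
  "pearson_uncentred x y = (x \<bullet> y) / (norm x * norm y)"

end

theory Submission
  imports Defs
begin

text \<open>
  Both coefficients are cosines of angles. For a set \<open>B\<close> of standard basis vectors let
  \<open>cos_on B x y\<close> be the cosine of the angle between the orthogonal projections of \<open>x\<close> and \<open>y\<close> onto
  the span of \<open>B\<close>. The uncentred coefficient is the case where \<open>B\<close> is the whole basis. Centring a
  vector is projecting it orthogonally to \<open>(1, ..., 1)\<close>; a reflection \<open>T\<close> that carries the normalised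
  vector \<open>(1, ..., 1)\<close> to a basis vector \<open>e\<close> turns this into the projection that deletes the
  coordinate of \<open>e\<close>. Hence the Pearson coefficient of \<open>x\<close> and \<open>y\<close> is \<open>cos_on (Basis - {e}) (T x) (T y)\<close>
  (\<open>pearson_eq_cos_on\<close>), and since \<open>T\<close> preserves spherical laws, both halves of the theorem are one
  statement about \<open>cos_on B\<close>, with \<open>card B\<close> equal to \<open>n - 1\<close> and to \<open>n\<close>.

  Independence. If \<open>Y\<close> is spherical, the law of \<open>cos_on B x Y\<close> is the same for every \<open>x\<close> whose
  projection is nonzero, because a reflection that commutes with the projection moves any direction in
  the span of \<open>B\<close> to any other (\<open>distr_cos_on_eq\<close>). So, conditionally on all the other vectors, the
  coefficient of the \<open>k\<close>-th and \<open>l\<close>-th vector has a fixed law, and it is therefore independent of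
  everything that does not involve the \<open>l\<close>-th vector (\<open>indep_var_constant_conditional_law\<close>). Of two
  distinct pairs of indices, each contains an index that the other one lacks, which gives pairwise
  independence.

  The common law. Let \<open>X\<close> and \<open>G\<close> be independent and spherical, with possibly different laws.
  Conditioning \<open>cos_on B X G\<close> on \<open>X\<close> produces the law belonging to \<open>G\<close>, and conditioning it on \<open>G\<close>
  produces the law belonging to \<open>X\<close>; so the two agree (\<open>distr_cos_on_unique\<close>). It is thus enough to
  know one spherical law for which the cosine can be computed, and the uniform law on the unit ball
  serves: in the coordinates \<open>a\<close> (along the fixed basis vector) and \<open>r\<close> (distance from its axis within
  the span of \<open>B\<close>) Lebesgue measure becomes a multiple of \<open>r ^ (card B - 2)\<close> times \<open>da dr\<close>, and
  substituting \<open>a = r * s\<close> and then \<open>t = s / sqrt (1 + s\<^sup>2)\<close> splits off the factor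
  \<open>(1 - t\<^sup>2) powr ((card B - 3) / 2)\<close> (\<open>nn_integral_PiM_cone\<close>, \<open>distr_cos_on_uniform_ball\<close>).
  The same exchange of \<open>X\<close> and \<open>G\<close> shows that a spherical law without an atom at \<open>0\<close> charges no
  hyperplane through the origin (\<open>rotation_invariant_AE_inner\<close>), so the projections are almost surely nonzero.
\<close>


section \<open>Reflections\<close>

definition reflect :: "'a::real_inner \<Rightarrow> 'a \<Rightarrow> 'a" where
  "reflect w x = x - (2 * (w \<bullet> x) / (w \<bullet> w)) *\<^sub>R w"

lemma reflect_inner: "reflect w x \<bullet> y = x \<bullet> reflect w y"
  by (simp add: reflect_def inner_diff_left inner_diff_right inner_commute)

lemma reflect_reflect: "reflect w (reflect w x) = x"
  by (cases "w = 0") (auto simp: reflect_def inner_diff_right algebra_simps)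

lemma orthogonal_transformation_reflect: "orthogonal_transformation (reflect w)"
  unfolding orthogonal_transformation_def
proof (intro conjI allI)
  show "linear (reflect w)"
    by (intro linearI) (simp_all add: reflect_def inner_add_right algebra_simps add_divide_distrib)
  show "reflect w x \<bullet> reflect w y = x \<bullet> y" for x y
    by (simp add: reflect_inner reflect_reflect)
qed

text \<open>
  The reflection in the hyperplane that bisects \<open>u\<close> and \<open>v\<close>. It fixes everything orthogonal to both, so
  the orthogonal maps constructed below can all be taken of this kind.
\<close>
lemma reflect_swap:
  assumes "norm u = norm v"
  shows "reflect (u - v) u = v"
proof (cases "u = v")
  case False
  have "(u - v) \<bullet> (u - v) = 2 * ((u - v) \<bullet> u)"
    using assms by (simp add: norm_eq inner_diff_left inner_diff_right inner_commute)
  moreover have "(u - v) \<bullet> (u - v) \<noteq> 0" using False by simp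
  ultimately have "2 * ((u - v) \<bullet> u) / ((u - v) \<bullet> (u - v)) = 1" by simp
  then show ?thesis by (simp only: reflect_def) simp
qed (simp add: reflect_def)

section \<open>Rotation invariance of Lebesgue measure\<close>

lemma emeasure_unit_ball:
  "emeasure lborel (ball (0::'a::euclidean_space) 1) \<noteq> 0"
  "emeasure lborel (ball (0::'a::euclidean_space) 1) \<noteq> \<top>"
proof -
  have "unit_ball_vol (real DIM('a)) > 0" by simp
  then have "\<not> unit_ball_vol (real DIM('a)) \<le> 0" by linarith
  then show "emeasure lborel (ball (0::'a::euclidean_space) 1) \<noteq> 0"
    unfolding emeasure_ball[OF zero_le_one] ennreal_eq_0_iff by simp
qed (simp add: emeasure_ball)

text \<open>
  Uniqueness of translation invariant measures by Fubini alone: for \<open>f\<close>, \<open>g\<close> the indicators of the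
  unit ball and of \<open>A\<close>, the double integral of \<open>f x * g (x + y)\<close> is \<open>\<integral> f d\<lambda> * \<integral> g dN\<close> when \<open>y\<close> is
  integrated first and \<open>\<integral> g d\<lambda> * \<integral> f dN\<close> when \<open>x\<close> is. The unit ball fixes the scale.
\<close>
lemma translation_invariant_eq_lborel:
  fixes N :: "'a::euclidean_space measure"
  assumes "sigma_finite_measure N" and [measurable_cong]: "sets N = sets borel"
    and inv: "\<And>a. distr N borel ((+) a) = N"
    and ball: "emeasure N (ball 0 1) = emeasure lborel (ball 0 1 :: 'a set)"
  shows "N = lborel"
proof (rule measure_eqI)
  interpret N: sigma_finite_measure N by fact
  interpret pair_sigma_finite lborel N ..
  fix A assume "A \<in> sets N"
  then have [measurable]: "A \<in> sets borel" by (simp add: assms)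
  let ?B = "ball (0::'a) 1"
  have tN: "(\<integral>\<^sup>+y. f (a + y) \<partial>N) = (\<integral>\<^sup>+y. f y \<partial>N)" if [measurable]: "f \<in> borel_measurable borel" for f a
    by (subst (2) inv[of a, symmetric]) (simp add: nn_integral_distr)
  have tL: "(\<integral>\<^sup>+y. f (a + y) \<partial>lborel) = (\<integral>\<^sup>+y. f y \<partial>lborel)" if [measurable]: "f \<in> borel_measurable borel" for f and a :: 'a
    by (subst (2) lborel_distr_plus[of a, symmetric]) (simp add: nn_integral_distr)
  define f :: "'a \<Rightarrow> ennreal" where "f = indicator ?B"
  define g :: "'a \<Rightarrow> ennreal" where "g = indicator A"
  have [measurable]: "f \<in> borel_measurable borel" "g \<in> borel_measurable borel"
    unfolding f_def g_def by (auto intro!: borel_measurable_indicator)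
  have int_f: "integral\<^sup>N lborel f = emeasure lborel ?B" "integral\<^sup>N N f = emeasure lborel ?B"
    using ball by (simp_all add: f_def nn_integral_indicator assms(2))
  have int_g: "integral\<^sup>N lborel g = emeasure lborel A" "integral\<^sup>N N g = emeasure N A"
    by (simp_all add: g_def nn_integral_indicator assms(2))
  have f_minus: "f (- y) = f y" for y
    by (simp add: f_def indicator_def)
  have "integral\<^sup>N N g * integral\<^sup>N lborel f = (\<integral>\<^sup>+x. f x * integral\<^sup>N N g \<partial>lborel)"
    by (simp add: nn_integral_multc mult.commute)
  also have "\<dots> = (\<integral>\<^sup>+x. \<integral>\<^sup>+y. f x * g (x + y) \<partial>N \<partial>lborel)"
    by (simp add: nn_integral_cmult tN)
  also have "\<dots> = (\<integral>\<^sup>+y. \<integral>\<^sup>+x. f x * g (x + y) \<partial>lborel \<partial>N)"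
    by (rule Fubini'[symmetric]) measurable
  also have "\<dots> = (\<integral>\<^sup>+y. \<integral>\<^sup>+x. f (x - y) * g x \<partial>lborel \<partial>N)"
  proof (rule nn_integral_cong)
    fix y :: 'a
    show "(\<integral>\<^sup>+x. f x * g (x + y) \<partial>lborel) = (\<integral>\<^sup>+x. f (x - y) * g x \<partial>lborel)"
      using tL[of "\<lambda>x. f (x - y) * g x" y] by (simp add: add.commute)
  qed
  also have "\<dots> = (\<integral>\<^sup>+x. \<integral>\<^sup>+y. f (x - y) * g x \<partial>N \<partial>lborel)"
    by (rule Fubini') measurable
  also have "\<dots> = (\<integral>\<^sup>+x. integral\<^sup>N N f * g x \<partial>lborel)"
  proof (rule nn_integral_cong)
    fix x :: 'a
    have "(\<integral>\<^sup>+y. f (x - y) * g x \<partial>N) = (\<integral>\<^sup>+y. f (x - y) \<partial>N) * g x"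
      by (simp add: nn_integral_multc)
    also have "(\<integral>\<^sup>+y. f (x - y) \<partial>N) = (\<integral>\<^sup>+y. f (x - (x + y)) \<partial>N)"
      by (rule tN[symmetric]) measurable
    finally show "(\<integral>\<^sup>+y. f (x - y) * g x \<partial>N) = integral\<^sup>N N f * g x"
      by (simp add: f_minus)
  qed
  also have "\<dots> = integral\<^sup>N lborel g * integral\<^sup>N lborel f"
    by (subst nn_integral_cmult) (simp_all add: int_f mult.commute)
  finally show "emeasure N A = emeasure lborel A"
    using emeasure_unit_ball[where 'a='a]
    by (simp add: int_f int_g ennreal_mult_cancel_left mult.commute[of _ "emeasure lborel ?B"])
qed (simp add: assms)

text \<open>
  The image measure is again translation invariant because \<open>a + T x = T (S a + x)\<close> for the inverse \<open>S\<close>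
  of \<open>T\<close>, and \<open>T\<close> maps the unit ball onto itself.
\<close>
lemma lborel_distr_orthogonal_transformation:
  fixes T :: "'a::euclidean_space \<Rightarrow> 'a"
  assumes "orthogonal_transformation T"
  shows "distr lborel borel T = lborel"
proof -
  obtain S where S: "orthogonal_transformation S" "T \<circ> S = id" "S \<circ> T = id"
    using assms by (metis orthogonal_transformation_inv orthogonal_transformation_bij bij_is_inj bij_is_surj inv_o_cancel surj_iff)
  have lin: "linear T" and [measurable]: "T \<in> borel \<rightarrow>\<^sub>M borel"
    using assms by (auto simp: orthogonal_transformation_linear linear_continuous_on linear_linear intro!: borel_measurable_continuous_onI)
  have TS: "T (S x) = x" for x using S by (metis comp_apply id_apply)
  show ?thesis
  proof (rule translation_invariant_eq_lborel)
    have vim: "T -` ball 0 r = ball 0 r" for r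
      using assms by (auto simp: dist_norm orthogonal_transformation_norm)
    show "sigma_finite_measure (distr lborel borel T)"
    proof
      show "\<exists>A. countable A \<and> A \<subseteq> sets (distr lborel borel T) \<and> \<Union>A = space (distr lborel borel T) \<and>
          (\<forall>a\<in>A. emeasure (distr lborel borel T) a \<noteq> \<infinity>)"
        by (intro exI[of _ "range (\<lambda>n::nat. ball 0 (real n))"])
          (auto simp: emeasure_distr vim emeasure_ball intro: reals_Archimedean2)
    qed
    show "emeasure (distr lborel borel T) (ball 0 1) = emeasure lborel (ball 0 1 :: 'a set)"
      by (simp add: emeasure_distr vim)
    fix a
    have "distr (distr lborel borel T) borel ((+) a) = distr lborel borel (\<lambda>x. a + T x)"
      by (simp add: distr_distr comp_def)
    also have "(\<lambda>x. a + T x) = (\<lambda>x. T (S a + x))"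
      using lin by (simp add: linear_add TS)
    also have "distr lborel borel \<dots> = distr (distr lborel borel ((+) (S a))) borel T"
      by (simp add: distr_distr comp_def)
    finally show "distr (distr lborel borel T) borel ((+) a) = distr lborel borel T"
      by (simp add: lborel_distr_plus)
  qed simp
qed

section \<open>Rotation invariant probability measures\<close>

definition rotation_invariant :: "'a::euclidean_space measure \<Rightarrow> bool" where
  "rotation_invariant D \<longleftrightarrow>
     sets D = sets borel \<and> (\<forall>T. orthogonal_transformation T \<longrightarrow> distr D borel T = D)"

lemma rotation_invariant_distr:
  "rotation_invariant D \<Longrightarrow> orthogonal_transformation T \<Longrightarrow> distr D borel T = D"
  by (simp add: rotation_invariant_def)

lemma measurable_orthogonal_transformation:
  fixes T :: "'a::euclidean_space \<Rightarrow> 'a"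
  shows "orthogonal_transformation T \<Longrightarrow> T \<in> borel \<rightarrow>\<^sub>M borel"
  by (auto simp: orthogonal_transformation_linear linear_continuous_on linear_linear
      intro!: borel_measurable_continuous_onI)

definition uniform_ball :: "'a::euclidean_space measure" where
  "uniform_ball = uniform_measure lborel (ball 0 1)"

lemma prob_space_uniform_ball: "prob_space uniform_ball"
  unfolding uniform_ball_def by (intro prob_space_uniform_measure) (simp_all add: emeasure_unit_ball)

lemma sets_uniform_ball [simp, measurable_cong]: "sets uniform_ball = sets borel"
  by (simp add: uniform_ball_def)

lemma rotation_invariant_uniform_ball: "rotation_invariant uniform_ball"
  unfolding rotation_invariant_def
proof (intro conjI allI impI measure_eqI)
  fix T :: "'a \<Rightarrow> 'a" and A :: "'a set"
  assume T: "orthogonal_transformation T"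
  note [measurable] = measurable_orthogonal_transformation[OF T]
  assume "A \<in> sets (distr uniform_ball borel T)"
  then have [measurable]: "A \<in> sets borel" by simp
  have m: "T -` A \<in> sets borel" "T -` (ball 0 1 \<inter> A) \<in> sets borel" 
    using measurable_sets[of T borel borel A] measurable_sets[of T borel borel "ball 0 1 \<inter> A"]
    by auto
  have "ball 0 1 \<inter> T -` A = T -` (ball 0 1 \<inter> A)"
    using T by (auto simp: dist_norm orthogonal_transformation_norm)
  also have "emeasure lborel \<dots> = emeasure (distr lborel borel T) (ball 0 1 \<inter> A)"
    by (simp add: emeasure_distr)
  also have "\<dots> = emeasure lborel (ball 0 1 \<inter> A)"
    by (simp add: lborel_distr_orthogonal_transformation T)
  finally show "emeasure (distr uniform_ball borel T) A = emeasure uniform_ball A"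
    using m by (simp add: emeasure_distr uniform_ball_def emeasure_uniform_measure)
qed simp_all

lemma AE_uniform_ball_inner:
  fixes e :: "'a::euclidean_space"
  assumes "e \<noteq> 0"
  shows "AE y in uniform_ball. e \<bullet> y \<noteq> 0"
proof -
  have "{y. e \<bullet> y = 0} \<in> null_sets lborel"
    using negligible_hyperplane[of e 0] assms
    by (auto simp: negligible_iff_null_sets null_sets_completion_iff)
  then have "AE y in lborel. e \<bullet> y \<noteq> 0"
    using AE_not_in by fastforce
  then show ?thesis
    unfolding uniform_ball_def by (intro AE_uniform_measureI) auto
qed

text \<open>
  Let \<open>y\<close> be uniform on the unit ball. For each fixed \<open>x \<noteq> 0\<close> almost surely \<open>x \<bullet> y \<noteq> 0\<close>, since
  hyperplanes are Lebesgue null. By Fubini some fixed \<open>y \<noteq> 0\<close> has \<open>x \<bullet> y \<noteq> 0\<close> for \<open>D\<close>-almost every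
  \<open>x\<close>, and a reflection carries the direction of this \<open>y\<close> to that of \<open>e\<close>.
\<close>
lemma rotation_invariant_AE_inner:
  fixes e :: "'a::euclidean_space"
  assumes D: "rotation_invariant D" "prob_space D" "AE x in D. x \<noteq> 0" and "e \<noteq> 0"
  shows "AE x in D. e \<bullet> x \<noteq> 0"
proof -
  interpret D: prob_space D by fact
  interpret U: prob_space "uniform_ball :: 'a measure" by (rule prob_space_uniform_ball)
  interpret pair_sigma_finite D "uniform_ball :: 'a measure" ..
  have [measurable_cong]: "sets D = sets borel" using D(1) by (simp add: rotation_invariant_def)
  have "AE x in D. AE y in uniform_ball. x \<bullet> y \<noteq> 0"
    using D(3) by eventually_elim (rule AE_uniform_ball_inner)
  then have "AE y in uniform_ball. AE x in D. x \<bullet> y \<noteq> 0"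
    by (subst (asm) AE_commute) measurable
  moreover have "AE y in uniform_ball. (y::'a) \<noteq> 0"
    using AE_uniform_ball_inner[OF \<open>e \<noteq> 0\<close>] by (rule eventually_mono) auto
  ultimately have "AE y in uniform_ball. y \<noteq> 0 \<and> (AE x in D. x \<bullet> y \<noteq> 0)"
    by eventually_elim auto
  then obtain y where y: "y \<noteq> 0" "AE x in D. x \<bullet> y \<noteq> 0"
    using eventually_happens' U.ae_filter_bot by blast
  define T where "T = reflect ((norm e / norm y) *\<^sub>R y - e)"
  have T: "orthogonal_transformation T" by (simp add: T_def orthogonal_transformation_reflect)
  note [measurable] = measurable_orthogonal_transformation[OF T]
  have Te: "T ((norm e / norm y) *\<^sub>R y) = e"
    using y(1) unfolding T_def by (intro reflect_swap) simp
  have *: "e \<bullet> T x \<noteq> 0" if "x \<bullet> y \<noteq> 0" for x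
  proof -
    have "e \<bullet> T x = ((norm e / norm y) *\<^sub>R y) \<bullet> x"
      using T Te by (metis orthogonal_transformation_def)
    then show ?thesis using that y(1) \<open>e \<noteq> 0\<close> by (simp add: inner_commute)
  qed
  have "AE x in D. e \<bullet> T x \<noteq> 0"
    using y(2) by eventually_elim (rule *)
  then have "AE x in distr D borel T. e \<bullet> x \<noteq> 0"
    by (subst AE_distr_iff) auto
  then show ?thesis unfolding rotation_invariant_distr[OF D(1) T] .
qed

section \<open>The cosine of the angle between two projections\<close>

definition coord_proj :: "'a::euclidean_space set \<Rightarrow> 'a \<Rightarrow> 'a" where
  "coord_proj B x = (\<Sum>b\<in>B. (x \<bullet> b) *\<^sub>R b)"

lemma inner_coord_proj: "coord_proj B x \<bullet> y = x \<bullet> coord_proj B y"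
  by (simp add: coord_proj_def inner_sum_left inner_sum_right inner_commute mult.commute)

lemma linear_coord_proj: "linear (coord_proj B)"
  by (intro linearI) (simp_all add: coord_proj_def inner_add_left scaleR_add_left sum.distrib scaleR_sum_right)

lemma coord_proj_inner_Basis:
  assumes "B \<subseteq> Basis" "b \<in> Basis"
  shows "coord_proj B x \<bullet> b = (if b \<in> B then x \<bullet> b else 0)"
proof -
  have "coord_proj B x \<bullet> b = (\<Sum>c\<in>B. if c = b then x \<bullet> b else 0)"
    unfolding coord_proj_def inner_sum_left
    by (intro sum.cong) (use assms in \<open>auto simp: inner_Basis subset_iff\<close>)
  then show ?thesis using finite_subset[OF assms(1)] by simp
qed

lemma coord_proj_idem: "B \<subseteq> Basis \<Longrightarrow> coord_proj B (coord_proj B x) = coord_proj B x"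
  by (simp add: euclidean_eq_iff[of "coord_proj B _"] coord_proj_inner_Basis)

lemma coord_proj_Basis: "B \<subseteq> Basis \<Longrightarrow> b \<in> B \<Longrightarrow> coord_proj B b = b"
  by (subst euclidean_eq_iff) (auto simp: coord_proj_inner_Basis inner_Basis)

lemma measurable_coord_proj [measurable]: "coord_proj B \<in> borel \<rightarrow>\<^sub>M borel"
  unfolding coord_proj_def by measurable

lemma reflect_coord_proj:
  assumes "B \<subseteq> Basis" "coord_proj B w = w"
  shows "coord_proj B (reflect w x) = reflect w (coord_proj B x)"
proof -
  have "w \<bullet> coord_proj B x = w \<bullet> x"
    by (metis assms(2) inner_coord_proj)
  then show ?thesis
    using assms by (simp add: reflect_def linear_diff[OF linear_coord_proj] linear_cmul[OF linear_coord_proj])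
qed

text \<open>
  With division by zero, the value is \<open>0\<close> when one of the projections vanishes.
\<close>
definition cos_on :: "'a::euclidean_space set \<Rightarrow> 'a \<Rightarrow> 'a \<Rightarrow> real" where
  "cos_on B x y = (coord_proj B x \<bullet> coord_proj B y) / (norm (coord_proj B x) * norm (coord_proj B y))"

lemma cos_on_commute: "cos_on B x y = cos_on B y x"
  by (simp add: cos_on_def inner_commute mult.commute)

lemma measurable_cos_on [measurable (raw)]:
  assumes [measurable]: "f \<in> borel_measurable M" "g \<in> borel_measurable M"
  shows "(\<lambda>x. cos_on B (f x) (g x)) \<in> borel_measurable M"
  unfolding cos_on_def by measurable

text \<open>
  The reflection that swaps \<open>b\<close> with the normalised projection of \<open>x\<close> has its normal vector in the span of \<open>B\<close>,
  so it commutes with the projection and turns \<open>cos_on B x\<close> into \<open>cos_on B b\<close>.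
\<close>
lemma distr_cos_on_eq:
  fixes D :: "'a::euclidean_space measure"
  assumes D: "rotation_invariant D" and B: "B \<subseteq> Basis" "b \<in> B" and x: "coord_proj B x \<noteq> 0"
  shows "distr D borel (cos_on B x) = distr D borel (cos_on B b)"
proof -
  define p where "p = coord_proj B x"
  define T where "T = reflect ((1 / norm p) *\<^sub>R p - b)"
  have T: "orthogonal_transformation T" by (simp add: T_def orthogonal_transformation_reflect)
  note [measurable] = measurable_orthogonal_transformation[OF T]
  have [measurable_cong]: "sets D = sets borel" using D by (simp add: rotation_invariant_def)
  have b: "coord_proj B b = b" "norm b = 1" using B by (auto simp: coord_proj_Basis)
  have "coord_proj B ((1 / norm p) *\<^sub>R p - b) = (1 / norm p) *\<^sub>R p - b"
    by (simp add: p_def linear_diff[OF linear_coord_proj] linear_cmul[OF linear_coord_proj] b coord_proj_idem B)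
  then have comm: "coord_proj B (T y) = T (coord_proj B y)" for y
    unfolding T_def by (rule reflect_coord_proj[OF B(1)])
  have Tp: "T ((1 / norm p) *\<^sub>R p) = b"
    unfolding T_def using x b by (intro reflect_swap) (simp add: p_def)
  have "cos_on B x (T y) = cos_on B b y" for y
  proof -
    have "p \<bullet> T (coord_proj B y) = norm p * ((1 / norm p) *\<^sub>R p \<bullet> T (coord_proj B y))"
      using x by (simp add: p_def)
    also have "\<dots> = norm p * (b \<bullet> coord_proj B y)"
      using Tp by (metis T_def reflect_inner)
    finally show ?thesis
      using x T by (simp add: cos_on_def comm b orthogonal_transformation_norm flip: p_def)
  qed
  then have "distr D borel (cos_on B b) = distr (distr D borel T) borel (cos_on B x)"
    by (subst distr_distr) (auto simp: comp_def)
  then show ?thesis unfolding rotation_invariant_distr[OF D T] by simp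
qed

text \<open>
  Both sides are the law of \<open>cos_on B X G\<close> for independent \<open>X\<close> with law \<open>D\<close> and \<open>G\<close> with law \<open>E\<close>: integrate
  out \<open>X\<close> first for the left-hand side and \<open>G\<close> first for the right-hand side.
\<close>
lemma distr_cos_on_unique:
  fixes D E :: "'a::euclidean_space measure"
  assumes D: "rotation_invariant D" "prob_space D" "AE x in D. coord_proj B x \<noteq> 0"
    and E: "rotation_invariant E" "prob_space E" "AE x in E. coord_proj B x \<noteq> 0"
    and B: "B \<subseteq> Basis" "b \<in> B"
  shows "distr D borel (cos_on B b) = distr E borel (cos_on B b)"
proof (rule measure_eqI)
  interpret D: prob_space D by fact
  interpret E: prob_space E by fact
  interpret pair_sigma_finite D E ..
  have [measurable_cong]: "sets D = sets borel" "sets E = sets borel"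
    using D(1) E(1) by (auto simp: rotation_invariant_def)
  fix A assume "A \<in> sets (distr D borel (cos_on B b))"
  then have [measurable]: "A \<in> sets borel" by simp
  have law: "(\<integral>\<^sup>+y. indicator A (cos_on B x y) \<partial>F) = emeasure (distr F borel (cos_on B b)) A"
    if F: "rotation_invariant F" and x: "coord_proj B x \<noteq> 0" for F x
  proof -
    have [measurable_cong]: "sets F = sets borel" using F by (auto simp: rotation_invariant_def)
    have "emeasure (distr F borel (cos_on B b)) A = (\<integral>\<^sup>+r. indicator A r \<partial>distr F borel (cos_on B x))"
      using distr_cos_on_eq[OF F B x] by simp
    also have "\<dots> = (\<integral>\<^sup>+y. indicator A (cos_on B x y) \<partial>F)"
      by (subst nn_integral_distr) auto
    finally show ?thesis by simp
  qed
  have "emeasure (distr D borel (cos_on B b)) A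
      = (\<integral>\<^sup>+y. emeasure (distr D borel (cos_on B b)) A \<partial>E)"
    by (simp add: E.emeasure_space_1)
  also have "\<dots> = (\<integral>\<^sup>+y. \<integral>\<^sup>+x. indicator A (cos_on B x y) \<partial>D \<partial>E)"
    using E(3) by (intro nn_integral_cong_AE) (auto elim!: eventually_mono simp: law[OF D(1)] cos_on_commute[of B _])
  also have "\<dots> = (\<integral>\<^sup>+x. \<integral>\<^sup>+y. indicator A (cos_on B x y) \<partial>E \<partial>D)"
    by (rule Fubini') measurable
  also have "\<dots> = (\<integral>\<^sup>+x. emeasure (distr E borel (cos_on B b)) A \<partial>D)"
    using D(3) by (intro nn_integral_cong_AE) (auto elim!: eventually_mono simp: law[OF E(1)])
  also have "\<dots> = emeasure (distr E borel (cos_on B b)) A"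
    by (simp add: D.emeasure_space_1)
  finally show "emeasure (distr D borel (cos_on B b)) A = emeasure (distr E borel (cos_on B b)) A" .
qed simp

section \<open>The law of the norm under Lebesgue measure\<close>

text \<open>
  The derivative of the volume of a \<open>k\<close>-dimensional ball with respect to its radius.
\<close>
definition radial_density :: "nat \<Rightarrow> real \<Rightarrow> real" where
  "radial_density k r = (if 0 \<le> r then real k * unit_ball_vol k * r ^ (k - 1) else 0)"

lemma measurable_radial_density [measurable]: "radial_density k \<in> borel \<rightarrow>\<^sub>M borel"
  unfolding radial_density_def by measurable

lemma radial_density_nonneg: "0 \<le> radial_density k r"
  by (simp add: radial_density_def)

text \<open>
  The half-lines \<open>{..a}\<close> generate the Borel sets, and their preimages under the norm are balls.
\<close>
lemma distr_norm_PiM: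
  fixes I :: "'i set"
  assumes I: "finite I" "I \<noteq> {}"
  shows "distr (PiM I (\<lambda>_. lborel)) borel (\<lambda>f. sqrt (\<Sum>i\<in>I. (f i)\<^sup>2)) = density lborel (radial_density (card I))"
    (is "?M = ?N")
proof (rule measure_eqI_generator_eq[where E="range (\<lambda>a::real. {..a})" and \<Omega>=UNIV and A="\<lambda>n. {..real n}"])
  define k where "k = card I"
  have k: "k > 0" using I by (simp add: k_def card_gt_0_iff)
  let ?P = "PiM I (\<lambda>_. lborel :: real measure)"
  have [measurable]: "(\<lambda>f. sqrt (\<Sum>i\<in>I. (f i)\<^sup>2)) \<in> borel_measurable ?P"
    by measurable
  have em: "emeasure ?M {..a} = emeasure ?P ({f. sqrt (\<Sum>i\<in>I. (f i)\<^sup>2) \<le> a} \<inter> space ?P)" for a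
    by (subst emeasure_distr) (auto intro!: arg_cong[where f="emeasure ?P"])
  have pos: "emeasure ?M {..a} = ennreal (unit_ball_vol k * a ^ k)" if "a > 0" for a
    using emeasure_cball_aux[OF I(1) that] by (simp add: em k_def)
  \<comment> \<open>The volume formula for balls needs a positive radius; radius \<open>0\<close> is the limit.\<close>
  have zero: "emeasure ?M {..a} = 0" if "a \<le> 0" for a
  proof -
    have "emeasure ?M {..a} \<le> 0"
    proof (rule tendsto_lowerbound)
      show "((\<lambda>x. ennreal (unit_ball_vol k * x ^ k)) \<longlongrightarrow> 0) (at_right 0)"
        using k by (auto intro!: tendsto_eq_intros simp flip: ennreal_0)
      show "eventually (\<lambda>x. emeasure ?M {..a} \<le> ennreal (unit_ball_vol k * x ^ k)) (at_right 0)"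
        using that by (auto simp: eventually_at_filter simp flip: pos intro!: always_eventually emeasure_mono)
    qed simp
    then show ?thesis by simp
  qed
  have rad: "emeasure ?N {..a} = ennreal (unit_ball_vol k * a ^ k)" if "a \<ge> 0" for a
  proof -
    have "emeasure ?N {..a} = (\<integral>\<^sup>+r. ennreal (real k * unit_ball_vol k * r ^ (k - 1)) * indicator {0..a} r \<partial>lborel)"
      by (subst emeasure_density) (auto simp: radial_density_def k_def intro!: nn_integral_cong split: split_indicator)
    also have "\<dots> = ennreal (unit_ball_vol k * a ^ k - unit_ball_vol k * 0 ^ k)"
    proof (rule nn_integral_FTC_Icc)
      fix x :: real
      show "((\<lambda>x. unit_ball_vol k * x ^ k) has_real_derivative real k * unit_ball_vol k * x ^ (k - 1)) (at x)"
        by (auto intro!: derivative_eq_intros)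
    qed (use that in auto)
    finally show ?thesis using k by (simp add: zero_power)
  qed
  have rad_neg: "emeasure ?N {..a} = 0" if "a < 0" for a
    using that by (subst emeasure_density)
      (auto simp: radial_density_def nn_integral_0_iff_AE split: split_indicator)
  show "emeasure ?M X = emeasure ?N X" if "X \<in> range (\<lambda>a::real. {..a})" for X
  proof -
    from that obtain a where X: "X = {..a}" by auto
    consider "a < 0" | "a = 0" | "a > 0" by linarith
    then show ?thesis using k by cases (simp_all add: X pos zero rad rad_neg)
  qed
  show "emeasure ?M {..real n} \<noteq> \<infinity>" for n
    by (cases "n = 0") (simp_all add: pos zero)
  show "Int_stable (range (\<lambda>a::real. {..a}))" by (auto simp: Int_stable_def)
  show "(\<Union>n. {..real n}) = UNIV" by (auto intro: real_arch_simple)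
  show "sets ?M = sigma_sets UNIV (range (\<lambda>a::real. {..a}))" "sets ?N = sigma_sets UNIV (range (\<lambda>a::real. {..a}))"
    by (simp_all add: borel_eq_atMost)
qed auto

section \<open>The symmetric beta density\<close>

text \<open>
  Up to the norming constant and an affine map of \<open>(-1, 1)\<close> onto \<open>(0, 1)\<close>, the density of the beta
  distribution with both parameters equal to \<open>c + 1\<close>.
\<close>
definition symmetric_beta :: "real \<Rightarrow> real \<Rightarrow> real" where
  "symmetric_beta c t = (if \<bar>t\<bar> < 1 then (1 - t\<^sup>2) powr c else 0)"

lemma measurable_symmetric_beta [measurable]: "symmetric_beta c \<in> borel \<rightarrow>\<^sub>M borel"
  unfolding symmetric_beta_def by measurable

lemma symmetric_beta_nonneg [simp]: "0 \<le> symmetric_beta c t"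
  by (simp add: symmetric_beta_def)

lemma Gamma_legendre_duplication_real:
  fixes z :: real
  assumes "z > 0"
  shows "Gamma z * Gamma (z + 1/2) = 2 powr (1 - 2 * z) * sqrt pi * Gamma (2 * z)"
proof -
  have "z \<notin> \<int>\<^sub>\<le>\<^sub>0" "z + 1/2 \<notin> \<int>\<^sub>\<le>\<^sub>0" using assms by (auto elim!: nonpos_Ints_cases)
  then have "complex_of_real z \<notin> \<int>\<^sub>\<le>\<^sub>0" "complex_of_real (z + 1/2) \<notin> \<int>\<^sub>\<le>\<^sub>0"
    by (simp_all only: of_real_in_nonpos_Ints_iff not_False_eq_True)
  then have "Gamma (complex_of_real z) * Gamma (complex_of_real (z + 1/2)) =
      exp (complex_of_real ((1 - 2 * z) * ln 2)) * of_real (sqrt pi) * Gamma (complex_of_real (2 * z))"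
    using Gamma_legendre_duplication[of "of_real z"] by simp
  then have "complex_of_real (Gamma z * Gamma (z + 1/2)) = of_real (exp ((1 - 2 * z) * ln 2) * sqrt pi * Gamma (2 * z))"
    by (simp only: Gamma_complex_of_real exp_of_real of_real_mult[symmetric])
  then show ?thesis by (simp only: of_real_eq_iff) (simp add: powr_def)
qed

text \<open>
  Substituting \<open>t = 2 * u - 1\<close> gives \<open>2 * 4 powr c * Beta (c + 1) (c + 1)\<close>, and the duplication formula
  brings this into the form used for the norming constants.
\<close>
lemma nn_integral_symmetric_beta:
  assumes "c > -1"
  shows "(\<integral>\<^sup>+t. symmetric_beta c t \<partial>lborel) = ennreal (sqrt pi * Gamma (c + 1) / Gamma (c + 3/2))"
proof -
  have "(\<integral>\<^sup>+t. symmetric_beta c t \<partial>lborel) = 2 * (\<integral>\<^sup>+u. symmetric_beta c (- 1 + 2 * u) \<partial>lborel)"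
    by (subst nn_integral_real_affine[of _ 2 "-1"]) auto
  also have "(\<integral>\<^sup>+u. symmetric_beta c (- 1 + 2 * u) \<partial>lborel)
      = (\<integral>\<^sup>+u. ennreal (4 powr c) * (ennreal (u powr c * (1 - u) powr c) * indicator {0..1} u) \<partial>lborel)"
  proof (rule nn_integral_cong_AE, rule AE_mp[OF AE_lborel_singleton[of 0] AE_mp[OF AE_lborel_singleton[of 1]]], intro AE_I2 impI)
    fix u :: real assume u: "u \<noteq> 1" "u \<noteq> 0"
    have "symmetric_beta c (- 1 + 2 * u) = 4 powr c * (u powr c * (1 - u) powr c)" if "0 < u" "u < 1"
    proof -
      have "1 - (- 1 + 2 * u)\<^sup>2 = 4 * (u * (1 - u))" by (simp add: power2_eq_square algebra_simps)
      moreover have "\<bar>- 1 + 2 * u\<bar> < 1" using that by auto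
      ultimately show ?thesis using that by (simp add: symmetric_beta_def powr_mult)
    qed
    moreover have "symmetric_beta c (- 1 + 2 * u) = 0" if "u < 0 \<or> 1 < u"
      using that by (auto simp: symmetric_beta_def)
    ultimately show "ennreal (symmetric_beta c (- 1 + 2 * u))
        = ennreal (4 powr c) * (ennreal (u powr c * (1 - u) powr c) * indicator {0..1} u)"
      using u by (cases "0 < u \<and> u < 1") (auto simp: ennreal_mult split: split_indicator)
  qed
  also have "\<dots> = ennreal (4 powr c) * ennreal (Beta (c + 1) (c + 1))"
    using has_integral_Beta_real[of "c + 1" "c + 1"] assms
    by (subst nn_integral_cmult) (auto intro!: arg_cong2[where f="(*)"] nn_integral_has_integral_lebesgue')
  also have "2 * (ennreal (4 powr c) * ennreal (Beta (c + 1) (c + 1)))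
      = ennreal (2 * 4 powr c * Beta (c + 1) (c + 1))"
    by (simp add: ennreal_mult' mult.assoc)
  also have "2 * 4 powr c * Beta (c + 1) (c + 1) = sqrt pi * Gamma (c + 1) / Gamma (c + 3/2)"
  proof -
    have G: "Gamma (c + 1) > 0" "Gamma (c + 3/2) > 0" "Gamma (2 * c + 2) > 0" using assms by (auto intro!: Gamma_real_pos)
    have "4 powr c = (2::real) powr (2 * c)" by (simp add: powr_powr[of 2 2 c, symmetric])
    then have p: "2 * 4 powr c * 2 powr (1 - 2 * (c + 1)) = (1::real)"
      by (simp add: powr_add[symmetric] powr_diff powr_add algebra_simps)
    have "Gamma (c + 1) * Gamma (c + 3/2) = 2 powr (1 - 2 * (c + 1)) * sqrt pi * Gamma (2 * c + 2)"
      using Gamma_legendre_duplication_real[of "c + 1"] assms by (simp add: algebra_simps)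
    then have "2 * 4 powr c * (Gamma (c + 1) * Gamma (c + 3/2)) = sqrt pi * Gamma (2 * c + 2)"
      using p by (simp add: mult.assoc[symmetric])
    then show ?thesis using G by (simp add: Beta_def field_simps)
  qed
  finally show ?thesis .
qed

text \<open>
  The map \<open>s \<mapsto> s / sqrt (1 + s\<^sup>2)\<close> sends the cotangent \<open>s\<close> of an angle between \<open>0\<close> and \<open>pi\<close> to its
  cosine \<open>t\<close>. It is a bijection of the line onto \<open>(-1, 1)\<close> with derivative \<open>(1 + s\<^sup>2) powr (- 3/2)\<close>, and \<open>1 - t\<^sup>2 = 1 / (1 + s\<^sup>2)\<close>.
\<close>
lemma nn_integral_symmetric_beta_substitution:
  assumes [measurable]: "A \<in> sets borel" and c: "c > -1"
  shows "(\<integral>\<^sup>+s. indicator A (s / sqrt (1 + s\<^sup>2)) * ennreal ((1 + s\<^sup>2) powr (- c - 3/2)) \<partial>lborel)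
       = (\<integral>\<^sup>+t. indicator A t * ennreal (symmetric_beta c t) \<partial>lborel)"
proof -
  define g :: "real \<Rightarrow> real" where "g = (\<lambda>s. s / sqrt (1 + s\<^sup>2))"
  define g' :: "real \<Rightarrow> real" where "g' = (\<lambda>s. (1 + s\<^sup>2) powr (- 3/2))"
  define f where "f = (\<lambda>t. indicator A t * symmetric_beta c t)"
  have pos: "1 + s\<^sup>2 > (0::real)" for s by (simp add: add_pos_nonneg)
  have g_sq: "1 - (g s)\<^sup>2 = 1 / (1 + s\<^sup>2)" for s
    using pos[of s] by (simp add: g_def power_divide field_simps)
  have g_lt: "\<bar>g s\<bar> < 1" for s
  proof -
    have "(g s)\<^sup>2 < 1" using g_sq[of s] pos[of s] by (smt (verit) divide_pos_pos)
    then show ?thesis by (simp add: abs_square_less_1)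
  qed
  have inv: "g s / sqrt (1 - (g s)\<^sup>2) = s" for s
    unfolding g_sq using pos[of s] by (simp add: g_def real_sqrt_divide)
  have img: "range g = {-1<..<1}"
  proof (intro equalityI subsetI)
    fix t :: real assume t: "t \<in> {-1<..<1}"
    then have "t\<^sup>2 < 1" by (simp add: abs_square_less_1 abs_less_iff)
    then have "1 + (t / sqrt (1 - t\<^sup>2))\<^sup>2 = 1 / (1 - t\<^sup>2)"
      by (simp add: power_divide field_simps)
    then have "g (t / sqrt (1 - t\<^sup>2)) = t"
      using \<open>t\<^sup>2 < 1\<close> by (simp add: g_def real_sqrt_divide)
    then show "t \<in> range g" by (metis rangeI)
  qed (use g_lt in \<open>auto simp: abs_less_iff\<close>)
  have deriv: "(g has_field_derivative g' s) (at s)" for s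
  proof -
    define h where "h = sqrt (1 + s\<^sup>2)"
    have h: "h > 0" "h\<^sup>2 = 1 + s\<^sup>2" using pos[of s] by (simp_all add: h_def)
    have "((\<lambda>s. sqrt (1 + s\<^sup>2)) has_field_derivative s / h) (at s)"
      unfolding h_def using pos[of s] by (auto intro!: derivative_eq_intros simp: divide_simps)
    from DERIV_divide[OF DERIV_ident this] have "(g has_field_derivative (h - s * (s / h)) / (h * h)) (at s)"
      using h(1) by (simp add: g_def h_def)
    moreover have "(h - s * (s / h)) / (h * h) = 1 / (h * h\<^sup>2)"
    proof -
      have "h - s * (s / h) = (h\<^sup>2 - s\<^sup>2) / h" using h(1) by (simp add: field_simps power2_eq_square)
      then show ?thesis using h by (simp add: power2_eq_square)
    qed
    moreover have "g' s = 1 / (h * h\<^sup>2)"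
    proof -
      have "g' s = (1 + s\<^sup>2) powr (- (1/2) + - 1)"
        by (simp add: g'_def)
      also have "\<dots> = (1 + s\<^sup>2) powr (- (1/2)) * (1 + s\<^sup>2) powr (- 1)"
        by (rule powr_add)
      also have "\<dots> = 1 / (h * h\<^sup>2)"
        using pos[of s] by (simp add: powr_minus_divide powr_half_sqrt h(2) flip: h_def)
      finally show ?thesis .
    qed
    ultimately show ?thesis by simp
  qed
  have fg: "\<bar>g' s\<bar> * f (g s) = indicator A (s / sqrt (1 + s\<^sup>2)) * (1 + s\<^sup>2) powr (- c - 3/2)" for s
  proof -
    have "symmetric_beta c (g s) = (1 + s\<^sup>2) powr (- c)"
      using pos[of s] g_lt[of s] by (simp add: symmetric_beta_def g_sq powr_divide powr_minus_divide)
    moreover have "- c - 3/2 = - (3/2) - c" by simp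
    ultimately show ?thesis by (simp only: f_def g'_def) (simp add: g_def powr_add[symmetric])
  qed
  have f_nonneg: "0 \<le> f t" for t by (simp add: f_def)
  have [measurable]: "f \<in> borel_measurable borel" by (simp add: f_def)
  have "(\<integral>\<^sup>+t. f t \<partial>lborel) \<le> (\<integral>\<^sup>+t. symmetric_beta c t \<partial>lborel)"
    by (intro nn_integral_mono) (auto simp: f_def split: split_indicator)
  also have "\<dots> < \<infinity>" using nn_integral_symmetric_beta[OF c] by simp
  finally have f_int: "integrable lborel f"
    by (intro integrableI_nonneg) (auto simp: f_nonneg)
  then have f_abs: "f absolutely_integrable_on UNIV"
    by (simp add: set_integrable_def integrable_completion)
  have f0: "f t = 0" if "t \<notin> {-1<..<1}" for t
    using that by (auto simp: f_def symmetric_beta_def)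
  have f_abs': "f absolutely_integrable_on {-1<..<1}"
    using f_abs by (rule set_integrable_subset) auto
  have eq: "integral {-1<..<1} f = integral\<^sup>L lborel f"
  proof -
    have "(f has_integral integral\<^sup>L lborel f) UNIV" using f_int by (rule has_integral_integral_lborel)
    moreover have "(\<lambda>x. if x \<in> {-1<..<1} then f x else 0) = f"
      by (rule ext) (simp add: f0 del: greaterThanLessThan_iff)
    ultimately have "(f has_integral integral\<^sup>L lborel f) {-1<..<1}"
      using has_integral_restrict_UNIV[of "{-1<..<1}" f] by simp
    then show ?thesis by (rule integral_unique)
  qed
  have "inj g" by (rule injI) (metis inv)
  then have "(\<lambda>s. \<bar>g' s\<bar> * f (g s)) absolutely_integrable_on UNIV \<and>
        integral UNIV (\<lambda>s. \<bar>g' s\<bar> * f (g s)) = integral\<^sup>L lborel f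
    \<longleftrightarrow> f absolutely_integrable_on range g \<and> integral (range g) f = integral\<^sup>L lborel f"
    by (intro has_absolute_integral_change_of_variables_1') (simp_all add: deriv)
  with f_abs' eq have "(\<lambda>s. \<bar>g' s\<bar> * f (g s)) absolutely_integrable_on UNIV"
    "integral UNIV (\<lambda>s. \<bar>g' s\<bar> * f (g s)) = integral\<^sup>L lborel f"
    unfolding img by blast+
  then have "((\<lambda>s. \<bar>g' s\<bar> * f (g s)) has_integral integral\<^sup>L lborel f) UNIV"
    by (metis has_integral_integral set_lebesgue_integral_eq_integral(1))
  then have "(\<integral>\<^sup>+s. ennreal (\<bar>g' s\<bar> * f (g s)) * indicator UNIV s \<partial>lborel) = ennreal (integral\<^sup>L lborel f)"
    by (intro nn_integral_has_integral_lebesgue') (simp_all add: f_nonneg)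
  also have "\<dots> = (\<integral>\<^sup>+t. f t \<partial>lborel)"
    using f_int by (simp add: nn_integral_eq_integral f_nonneg)
  finally show ?thesis
    unfolding fg by (simp add: f_def ennreal_mult' ennreal_indicator)
qed

section \<open>The law of the cosine for the uniform ball\<close>

text \<open>
  For a rotation invariant weight \<open>\<Phi>\<close> the angle to the axis \<open>i\<close> and the norm separate. Write \<open>a\<close> for the
  coordinate \<open>f i\<close> and \<open>r\<close> for the norm of the other coordinates; substituting \<open>a = r * s\<close> makes the
  angle a function of its cotangent \<open>s\<close> alone, and substituting \<open>q = r * sqrt (1 + s\<^sup>2)\<close>, the norm of the whole
  vector, leaves as \<open>C\<close> an integral over \<open>q\<close> that involves \<open>\<Phi>\<close> but not \<open>A\<close>.
\<close>
lemma nn_integral_PiM_cone: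
  fixes \<Phi> :: "real \<Rightarrow> ennreal" and I :: "'i set"
  assumes [measurable]: "\<Phi> \<in> borel_measurable borel" and I: "finite I" "I \<noteq> {}" "i \<notin> I"
  obtains C where "\<And>A. A \<in> sets borel \<Longrightarrow>
     (\<integral>\<^sup>+f. indicator A (f i / sqrt (\<Sum>j\<in>insert i I. (f j)\<^sup>2)) * \<Phi> (\<Sum>j\<in>insert i I. (f j)\<^sup>2)
        \<partial>PiM (insert i I) (\<lambda>_. lborel))
     = C * (\<integral>\<^sup>+t. indicator A t * ennreal (symmetric_beta ((real (card I) - 2) / 2) t) \<partial>lborel)"
proof
  interpret product_sigma_finite "\<lambda>_::'i. lborel :: real measure" ..
  define k where "k = card I"
  have k: "k \<ge> 1" using I by (simp add: k_def card_gt_0_iff Suc_le_eq)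
  let ?v = "\<lambda>r. ennreal (radial_density k r)"
  define C where "C = (\<integral>\<^sup>+q. ?v q * ennreal q * \<Phi> (q\<^sup>2) \<partial>lborel)"
  fix A :: "real set" assume [measurable]: "A \<in> sets borel"
  define G where "G = (\<lambda>a r. indicator A (a / sqrt (a\<^sup>2 + r\<^sup>2)) * \<Phi> (a\<^sup>2 + r\<^sup>2))"
  have [measurable]: "(\<lambda>(a, r). G a r) \<in> borel_measurable (borel \<Otimes>\<^sub>M borel)"
    unfolding G_def by measurable
  have scale: "(\<integral>\<^sup>+a. ?v r * G a r \<partial>lborel) =
      (\<integral>\<^sup>+s. indicator A (s / sqrt (1 + s\<^sup>2)) * (?v r * ennreal r * \<Phi> (r\<^sup>2 * (1 + s\<^sup>2))) \<partial>lborel)"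
    if "r \<noteq> 0" for r
  proof (cases "r > 0")
    case True
    have e: "(r * s)\<^sup>2 + r\<^sup>2 = r\<^sup>2 * (1 + s\<^sup>2)" for s
      by (simp add: power2_eq_square algebra_simps)
    have q: "r * s / sqrt (r\<^sup>2 * (1 + s\<^sup>2)) = s / sqrt (1 + s\<^sup>2)" for s
      using True by (simp add: real_sqrt_mult)
    have "G (r * s) r = indicator A (s / sqrt (1 + s\<^sup>2)) * \<Phi> (r\<^sup>2 * (1 + s\<^sup>2))" for s
      by (simp only: G_def e q)
    then show ?thesis using True
      by (subst nn_integral_real_affine[of _ r 0])
        (auto simp: nn_integral_cmult[symmetric] mult_ac intro!: nn_integral_cong)
  next
    case False
    with that have "radial_density k r = 0" by (simp add: radial_density_def)
    then show ?thesis by simp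
  qed
  have radial: "(\<integral>\<^sup>+r. ?v r * ennreal r * \<Phi> (r\<^sup>2 * (1 + s\<^sup>2)) \<partial>lborel)
      = ennreal ((1 + s\<^sup>2) powr (- ((real k - 2) / 2) - 3/2)) * C" for s
  proof -
    define h where "h = sqrt (1 + s\<^sup>2)"
    have pos: "1 + s\<^sup>2 > 0" by (simp add: add_pos_nonneg)
    then have h: "h > 0" "h\<^sup>2 = 1 + s\<^sup>2" by (simp_all add: h_def)
    have hp: "(1 + s\<^sup>2) powr (- ((real k - 2) / 2) - 3/2) = (1 / h) ^ Suc k"
    proof -
      have e: "- ((real k - 2) / 2) - 3/2 = - (real (Suc k) / 2)" by (simp add: field_simps)
      have "(1 + s\<^sup>2) powr (- ((real k - 2) / 2) - 3/2) = (h powr 2) powr (- (real (Suc k) / 2))"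
        unfolding e using h by simp
      also have "\<dots> = h powr (- real (Suc k))" by (simp add: powr_powr add_divide_distrib)
      also have "\<dots> = (1 / h) ^ Suc k"
        by (simp only: powr_minus_divide powr_realpow[OF h(1)] power_one_over)
      finally show ?thesis .
    qed
    have "(\<integral>\<^sup>+r. ?v r * ennreal r * \<Phi> (r\<^sup>2 * (1 + s\<^sup>2)) \<partial>lborel)
      = ennreal (1 / h) * (\<integral>\<^sup>+q. ?v (q / h) * ennreal (q / h) * \<Phi> (q\<^sup>2) \<partial>lborel)"
      using h pos by (subst nn_integral_real_affine[of _ "1 / h" 0]) (simp_all add: h(2)[symmetric] power_divide)
    also have "\<dots> = (\<integral>\<^sup>+q. ennreal ((1 / h) ^ Suc k) * (?v q * ennreal q * \<Phi> (q\<^sup>2)) \<partial>lborel)"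
    proof (subst nn_integral_cmult[symmetric], measurable, rule nn_integral_cong)
      fix q :: real
      show "ennreal (1 / h) * (?v (q / h) * ennreal (q / h) * \<Phi> (q\<^sup>2)) = ennreal ((1 / h) ^ Suc k) * (?v q * ennreal q * \<Phi> (q\<^sup>2))"
      proof (cases "q \<ge> 0")
        case True
        have "1 / h * (radial_density k (q / h) * (q / h)) = (1 / h) ^ Suc k * (radial_density k q * q)"
          using True h k by (cases k) (simp_all add: radial_density_def power_divide field_simps)
        then have "ennreal (1 / h) * (?v (q / h) * ennreal (q / h)) = ennreal ((1 / h) ^ Suc k) * (?v q * ennreal q)"
          using True h by (simp add: ennreal_mult[symmetric] radial_density_nonneg del: power_Suc)
        then show ?thesis by (simp add: mult.assoc[symmetric])
      next
        case False
        with h have "q / h < 0" by (simp add: divide_neg_pos)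
        then show ?thesis using False by (simp add: radial_density_def)
      qed
    qed
    also have "\<dots> = ennreal ((1 + s\<^sup>2) powr (- ((real k - 2) / 2) - 3/2)) * C"
      unfolding hp C_def by (rule nn_integral_cmult) measurable
    finally show ?thesis .
  qed
  have "(\<integral>\<^sup>+f. indicator A (f i / sqrt (\<Sum>j\<in>insert i I. (f j)\<^sup>2)) * \<Phi> (\<Sum>j\<in>insert i I. (f j)\<^sup>2)
        \<partial>PiM (insert i I) (\<lambda>_. lborel)) = (\<integral>\<^sup>+a. \<integral>\<^sup>+f. G a (sqrt (\<Sum>j\<in>I. (f j)\<^sup>2)) \<partial>PiM I (\<lambda>_. lborel) \<partial>lborel)"
  proof (subst product_nn_integral_insert_rev[OF I(1) I(3)])
    have "(\<Sum>j\<in>I. ((f(i := a)) j)\<^sup>2) = (\<Sum>j\<in>I. (f j)\<^sup>2)" for f :: "'i \<Rightarrow> real" and a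
      using I by (intro sum.cong) auto
    then show "(\<integral>\<^sup>+a. \<integral>\<^sup>+f. indicator A ((f(i := a)) i / sqrt (\<Sum>j\<in>insert i I. ((f(i := a)) j)\<^sup>2)) * \<Phi> (\<Sum>j\<in>insert i I. ((f(i := a)) j)\<^sup>2)
        \<partial>PiM I (\<lambda>_. lborel) \<partial>lborel) = (\<integral>\<^sup>+a. \<integral>\<^sup>+f. G a (sqrt (\<Sum>j\<in>I. (f j)\<^sup>2)) \<partial>PiM I (\<lambda>_. lborel) \<partial>lborel)"
      using I by (simp add: G_def sum_nonneg)
  qed measurable
  also have "\<dots> = (\<integral>\<^sup>+a. \<integral>\<^sup>+r. G a r \<partial>distr (PiM I (\<lambda>_. lborel)) borel (\<lambda>f. sqrt (\<Sum>i\<in>I. (f i)\<^sup>2)) \<partial>lborel)"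
    by (intro nn_integral_cong, subst nn_integral_distr) measurable
  also have "\<dots> = (\<integral>\<^sup>+a. \<integral>\<^sup>+r. ?v r * G a r \<partial>lborel \<partial>lborel)"
    by (simp add: distr_norm_PiM[OF I(1,2)] nn_integral_density flip: k_def)
  also have "\<dots> = (\<integral>\<^sup>+r. \<integral>\<^sup>+a. ?v r * G a r \<partial>lborel \<partial>lborel)"
    by (rule lborel_pair.Fubini') measurable
  also have "\<dots> = (\<integral>\<^sup>+r. \<integral>\<^sup>+s. indicator A (s / sqrt (1 + s\<^sup>2)) * (?v r * ennreal r * \<Phi> (r\<^sup>2 * (1 + s\<^sup>2))) \<partial>lborel \<partial>lborel)"
    by (rule nn_integral_cong_AE, rule AE_mp[OF AE_lborel_singleton[of 0]]) (auto simp: scale)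
  also have "\<dots> = (\<integral>\<^sup>+s. \<integral>\<^sup>+r. indicator A (s / sqrt (1 + s\<^sup>2)) * (?v r * ennreal r * \<Phi> (r\<^sup>2 * (1 + s\<^sup>2))) \<partial>lborel \<partial>lborel)"
    by (rule lborel_pair.Fubini') measurable
  also have "\<dots> = (\<integral>\<^sup>+s. C * (indicator A (s / sqrt (1 + s\<^sup>2)) * ennreal ((1 + s\<^sup>2) powr (- ((real k - 2) / 2) - 3/2))) \<partial>lborel)"
    by (rule nn_integral_cong, subst nn_integral_cmult, measurable, unfold radial) (simp only: mult_ac)
  also have "\<dots> = C * (\<integral>\<^sup>+s. indicator A (s / sqrt (1 + s\<^sup>2)) * ennreal ((1 + s\<^sup>2) powr (- ((real k - 2) / 2) - 3/2)) \<partial>lborel)"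
    by (rule nn_integral_cmult) measurable
  also have "\<dots> = C * (\<integral>\<^sup>+t. indicator A t * ennreal (symmetric_beta ((real k - 2) / 2) t) \<partial>lborel)"
    using k by (subst nn_integral_symmetric_beta_substitution) auto
  finally show "(\<integral>\<^sup>+f. indicator A (f i / sqrt (\<Sum>j\<in>insert i I. (f j)\<^sup>2)) * \<Phi> (\<Sum>j\<in>insert i I. (f j)\<^sup>2)
        \<partial>PiM (insert i I) (\<lambda>_. lborel))
     = C * (\<integral>\<^sup>+t. indicator A t * ennreal (symmetric_beta ((real (card I) - 2) / 2) t) \<partial>lborel)"
    unfolding k_def .
qed

lemma inner_coord_proj_coord_proj:
  assumes "B \<subseteq> Basis"
  shows "coord_proj B x \<bullet> coord_proj B y = (\<Sum>c\<in>B. (x \<bullet> c) * (y \<bullet> c))"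
proof -
  have "coord_proj B x \<bullet> coord_proj B y = x \<bullet> coord_proj B y"
    by (simp add: inner_coord_proj coord_proj_idem assms)
  then show ?thesis by (simp add: coord_proj_def inner_sum_right mult.commute)
qed

lemma cos_on_Basis:
  assumes "B \<subseteq> Basis" "b \<in> B"
  shows "cos_on B b x = (x \<bullet> b) / sqrt (\<Sum>c\<in>B. (x \<bullet> c)\<^sup>2)"
proof -
  have "coord_proj B b \<bullet> coord_proj B x = x \<bullet> b"
    using assms by (metis coord_proj_Basis inner_coord_proj inner_commute)
  moreover have "norm (coord_proj B b) = 1"
    using assms by (auto simp: coord_proj_Basis)
  ultimately show ?thesis
    using inner_coord_proj_coord_proj[OF assms(1), of x x]
    by (simp add: cos_on_def norm_eq_sqrt_inner power2_eq_square)
qed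

text \<open>
  The coordinates outside \<open>B\<close> are integrated out first. What remains is a weight \<open>\<Phi>\<close> depending only on the
  norm of the coordinates in \<open>B\<close>, so the law is a multiple of the symmetric beta density, and the
  total mass \<open>1\<close> determines the multiple.
\<close>
lemma distr_cos_on_uniform_ball:
  fixes B :: "'a::euclidean_space set"
  assumes B: "B \<subseteq> Basis" "b \<in> B" "2 \<le> card B"
  defines "c \<equiv> (real (card B) - 3) / 2"
  shows "distr uniform_ball borel (cos_on B b) =
    density lborel (\<lambda>t. ennreal (Gamma (c + 3/2) / (sqrt pi * Gamma (c + 1)) * symmetric_beta c t))"
    (is "?L = density lborel (\<lambda>t. ennreal (?K * _ t))")
proof (rule measure_eqI)
  interpret product_sigma_finite "\<lambda>_::'a. lborel :: real measure" ..
  interpret U: prob_space "uniform_ball :: 'a measure" by (rule prob_space_uniform_ball)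
  let ?P = "\<lambda>I. PiM I (\<lambda>_::'a. lborel :: real measure)"
  let ?J = "Basis - B"
  define I where "I = B - {b}"
  have fin: "finite B" using B(1) finite_Basis by (rule finite_subset)
  have I: "insert b I = B" "b \<notin> I" "finite I" "I \<noteq> {}" "card I = card B - 1"
  proof -
    show card: "card I = card B - 1" using B(2) fin by (simp add: I_def)
    then show "I \<noteq> {}" using B(3) by auto
  qed (use B(2) fin in \<open>auto simp: I_def\<close>)
  have c: "(real (card I) - 2) / 2 = c" "c > -1"
    using B(3) by (simp_all add: I(5) c_def)
  interpret J: finite_product_sigma_finite "\<lambda>_::'a. lborel :: real measure" ?J by standard auto
  define \<Phi> :: "real \<Rightarrow> ennreal" where "\<Phi> = (\<lambda>s. \<integral>\<^sup>+g. indicator {..<1} (s + (\<Sum>c\<in>?J. (g c)\<^sup>2)) \<partial>?P ?J)"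
  have [measurable]: "\<Phi> \<in> borel_measurable borel"
    unfolding \<Phi>_def by measurable
  obtain C where C: "\<And>A. A \<in> sets borel \<Longrightarrow>
     (\<integral>\<^sup>+f. indicator A (f b / sqrt (\<Sum>j\<in>insert b I. (f j)\<^sup>2)) * \<Phi> (\<Sum>j\<in>insert b I. (f j)\<^sup>2) \<partial>?P (insert b I))
     = C * (\<integral>\<^sup>+t. indicator A t * ennreal (symmetric_beta ((real (card I) - 2) / 2) t) \<partial>lborel)"
    using nn_integral_PiM_cone[of \<Phi> I b] I by auto
  let ?V = "emeasure lborel (ball (0::'a) 1)"
  have main: "emeasure ?L A = C / ?V * (\<integral>\<^sup>+t. indicator A t * ennreal (symmetric_beta c t) \<partial>lborel)"
    if [measurable]: "A \<in> sets borel" for A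
  proof -
    define h :: "('a \<Rightarrow> real) \<Rightarrow> ennreal" where
      "h = (\<lambda>f. indicator A (f b / sqrt (\<Sum>c\<in>B. (f c)\<^sup>2)) * indicator {..<1} ((\<Sum>c\<in>B. (f c)\<^sup>2) + (\<Sum>c\<in>?J. (f c)\<^sup>2)))"
    have [measurable]: "b \<in> Basis" "\<And>c. c \<in> B \<Longrightarrow> c \<in> Basis" using B by auto
    have [measurable]: "h \<in> borel_measurable (?P Basis)"
      unfolding h_def by measurable
    have "emeasure ?L A = (\<integral>\<^sup>+r. indicator A r \<partial>?L)"
      by simp
    also have "\<dots> = (\<integral>\<^sup>+x. indicator A (cos_on B b x) \<partial>uniform_ball)"
      by (subst nn_integral_distr) auto
    also have "\<dots> = (\<integral>\<^sup>+x. indicator A (cos_on B b x) * indicator (ball 0 1) x \<partial>lborel) / ?V"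
      unfolding uniform_ball_def by (subst nn_integral_uniform_measure) auto
    also have "(\<integral>\<^sup>+x. indicator A (cos_on B b x) * indicator (ball 0 1) x \<partial>(lborel :: 'a measure)) = (\<integral>\<^sup>+f. h f \<partial>?P Basis)"
    proof -
      have "indicator A (cos_on B b (\<Sum>c\<in>Basis. f c *\<^sub>R c)) * indicator (ball 0 1) (\<Sum>c\<in>Basis. f c *\<^sub>R c :: 'a) = h f" for f
      proof -
        let ?x = "\<Sum>c\<in>Basis. f c *\<^sub>R c :: 'a"
        have x: "?x \<bullet> c = f c" if "c \<in> Basis" for c
          using that by (simp add: inner_sum_left inner_Basis if_distrib cong: if_cong)
        have "(norm ?x)\<^sup>2 = (\<Sum>c\<in>Basis. (?x \<bullet> c) * (?x \<bullet> c))"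
          unfolding power2_norm_eq_inner by (rule euclidean_inner)
        also have "\<dots> = (\<Sum>c\<in>Basis. (f c)\<^sup>2)"
          by (rule sum.cong) (simp_all only: x power2_eq_square)
        also have "\<dots> = (\<Sum>c\<in>B. (f c)\<^sup>2) + (\<Sum>c\<in>?J. (f c)\<^sup>2)"
          by (subst sum.subset_diff[OF B(1)]) (simp_all add: add.commute)
        finally have "?x \<in> ball 0 1 \<longleftrightarrow> (\<Sum>c\<in>B. (f c)\<^sup>2) + (\<Sum>c\<in>?J. (f c)\<^sup>2) < 1"
          by (metis abs_norm_cancel abs_square_less_1 mem_ball_0)
        moreover have "cos_on B b ?x = f b / sqrt (\<Sum>c\<in>B. (f c)\<^sup>2)"
          using B by (subst cos_on_Basis) (auto simp: x subset_iff intro!: sum.cong arg_cong2[where f="(/)"] arg_cong[where f=sqrt])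
        ultimately show ?thesis by (simp add: h_def indicator_def)
      qed
      moreover have "(\<lambda>x::'a. indicator A (cos_on B b x) * indicator (ball 0 1) x :: ennreal) \<in> borel_measurable borel"
      proof (rule borel_measurable_times_ennreal)
        show "(\<lambda>x. indicator A (cos_on B b x) :: ennreal) \<in> borel_measurable borel" by measurable
        show "(indicator (ball 0 1) :: 'a \<Rightarrow> ennreal) \<in> borel_measurable borel" by (auto intro!: borel_measurable_indicator)
      qed
      ultimately show ?thesis
        by (subst lborel_eq, subst nn_integral_distr) auto
    qed
    also have "(\<integral>\<^sup>+f. h f \<partial>?P Basis) = (\<integral>\<^sup>+f. \<integral>\<^sup>+g. h (merge B ?J (f, g)) \<partial>?P ?J \<partial>?P B)"
    proof -
      have "B \<union> ?J = Basis" using B by auto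
      then show ?thesis using product_nn_integral_fold[of B ?J h] fin by auto
    qed
    also have "\<dots> = (\<integral>\<^sup>+f. indicator A (f b / sqrt (\<Sum>c\<in>B. (f c)\<^sup>2)) * \<Phi> (\<Sum>c\<in>B. (f c)\<^sup>2) \<partial>?P B)"
    proof (rule nn_integral_cong)
      fix f :: "'a \<Rightarrow> real"
      have "(\<Sum>c\<in>?J. (merge B ?J (f, g) c)\<^sup>2) = (\<Sum>c\<in>?J. (g c)\<^sup>2)" for g
        by (intro sum.cong) (auto simp: merge_def)
      moreover have "(\<Sum>c\<in>B. (merge B ?J (f, g) c)\<^sup>2) = (\<Sum>c\<in>B. (f c)\<^sup>2)" for g
        by (intro sum.cong) (auto simp: merge_def)
      ultimately have "h (merge B ?J (f, g)) = indicator A (f b / sqrt (\<Sum>c\<in>B. (f c)\<^sup>2)) * indicator {..<1} ((\<Sum>c\<in>B. (f c)\<^sup>2) + (\<Sum>c\<in>?J. (g c)\<^sup>2))" for g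
        using B(2) by (simp add: h_def merge_def)
      then show "(\<integral>\<^sup>+g. h (merge B ?J (f, g)) \<partial>?P ?J) = indicator A (f b / sqrt (\<Sum>c\<in>B. (f c)\<^sup>2)) * \<Phi> (\<Sum>c\<in>B. (f c)\<^sup>2)"
        unfolding \<Phi>_def by (simp add: nn_integral_cmult)
    qed
    also have "\<dots> = C * (\<integral>\<^sup>+t. indicator A t * ennreal (symmetric_beta c t) \<partial>lborel)"
      using C[OF that] unfolding I(1) c(1) .
    finally show ?thesis by (simp add: divide_ennreal_def mult_ac)
  qed
  have G: "Gamma (c + 1) > 0" "Gamma (c + 3/2) > 0" using c(2) by (auto intro!: Gamma_real_pos)
  have "emeasure ?L UNIV = 1"
    using U.emeasure_space_1 by (subst emeasure_distr) (auto simp: space_uniform_measure uniform_ball_def)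
  then have one: "C / ?V * ennreal (sqrt pi * Gamma (c + 1) / Gamma (c + 3/2)) = 1"
    using main[of UNIV] nn_integral_symmetric_beta[OF c(2)] by simp
  have "ennreal (sqrt pi * Gamma (c + 1) / Gamma (c + 3/2)) * ennreal ?K
      = ennreal (sqrt pi * Gamma (c + 1) / Gamma (c + 3/2) * ?K)"
    by (rule ennreal_mult[symmetric]) (use G in auto)
  also have "sqrt pi * Gamma (c + 1) / Gamma (c + 3/2) * ?K = 1" using G by simp
  finally have "ennreal (sqrt pi * Gamma (c + 1) / Gamma (c + 3/2)) * ennreal ?K = 1"
    by (simp only: ennreal_1)
  then have "C / ?V = C / ?V * (ennreal (sqrt pi * Gamma (c + 1) / Gamma (c + 3/2)) * ennreal ?K)"
    by simp
  also have "\<dots> = ennreal ?K"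
    using one by (simp add: mult.assoc[symmetric])
  finally have K: "C / ?V = ennreal ?K" .
  fix A assume "A \<in> sets ?L"
  then have [measurable]: "A \<in> sets borel" by simp
  have "emeasure (density lborel (\<lambda>t. ennreal (?K * symmetric_beta c t))) A
      = (\<integral>\<^sup>+t. ennreal (?K * symmetric_beta c t) * indicator A t \<partial>lborel)"
    by (rule emeasure_density) auto
  also have "\<dots> = (\<integral>\<^sup>+t. ennreal ?K * (indicator A t * ennreal (symmetric_beta c t)) \<partial>lborel)"
  proof (rule nn_integral_cong)
    fix t
    have "ennreal (?K * symmetric_beta c t) = ennreal ?K * ennreal (symmetric_beta c t)"
      by (rule ennreal_mult) (use G in auto)
    then show "ennreal (?K * symmetric_beta c t) * indicator A t = ennreal ?K * (indicator A t * ennreal (symmetric_beta c t))"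
      by (simp only: mult_ac)
  qed
  also have "\<dots> = ennreal ?K * (\<integral>\<^sup>+t. indicator A t * ennreal (symmetric_beta c t) \<partial>lborel)"
    by (rule nn_integral_cmult) measurable
  also have "\<dots> = emeasure ?L A"
    by (simp only: main[OF \<open>A \<in> sets borel\<close>] K)
  finally show "emeasure ?L A = emeasure (density lborel (\<lambda>t. ennreal (?K * symmetric_beta c t))) A" ..
qed simp

section \<open>Independence from a constant conditional law\<close>

text \<open>
  By Fubini, if \<open>g z W\<close> has the law \<open>\<mu>\<close> for almost every \<open>z\<close>, then
  \<open>P (f Z \<in> A \<and> g Z W \<in> B) = \<integral> indicator A (f z) * \<mu> B = P (f Z \<in> A) * \<mu> B\<close>.
\<close>
lemma (in prob_space) indep_var_constant_conditional_law:
  fixes f :: "'z \<Rightarrow> real" and g :: "'z \<Rightarrow> 'z \<Rightarrow> real"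
  assumes ind: "indep_var S Z T W"
    and f [measurable]: "f \<in> borel_measurable S"
    and g [measurable]: "case_prod g \<in> borel_measurable (S \<Otimes>\<^sub>M T)"
    and law: "AE z in distr M S Z. distr (distr M T W) borel (g z) = \<mu>"
  shows "distr M borel (\<lambda>\<omega>. g (Z \<omega>) (W \<omega>)) = \<mu>"
    and "indep_var borel (\<lambda>\<omega>. f (Z \<omega>)) borel (\<lambda>\<omega>. g (Z \<omega>) (W \<omega>))"
proof -
  have [measurable]: "Z \<in> M \<rightarrow>\<^sub>M S" "W \<in> M \<rightarrow>\<^sub>M T"
    and joint: "distr M S Z \<Otimes>\<^sub>M distr M T W = distr M (S \<Otimes>\<^sub>M T) (\<lambda>\<omega>. (Z \<omega>, W \<omega>))"
    using ind by (auto simp: indep_var_distribution_eq)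
  let ?X = "\<lambda>\<omega>. f (Z \<omega>)" and ?Y = "\<lambda>\<omega>. g (Z \<omega>) (W \<omega>)"
  let ?XY = "distr M (borel \<Otimes>\<^sub>M borel) (\<lambda>\<omega>. (?X \<omega>, ?Y \<omega>))"
  have [measurable]: "?Y \<in> borel_measurable M" by measurable
  interpret Z: prob_space "distr M S Z" by (rule prob_space_distr) measurable
  interpret W: prob_space "distr M T W" by (rule prob_space_distr) measurable
  interpret X: prob_space "distr M borel ?X" by (rule prob_space_distr) measurable
  interpret Y: prob_space "distr M borel ?Y" by (rule prob_space_distr) measurable
  have "\<exists>z. distr (distr M T W) borel (g z) = \<mu>"
    using eventually_happens'[OF Z.ae_filter_bot law] by blast
  then have sets_\<mu> [measurable_cong]: "sets \<mu> = sets borel" by (metis sets_distr)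
  have rect: "emeasure ?XY (A \<times> B) = emeasure (distr M borel ?X) A * emeasure \<mu> B"
    if [measurable]: "A \<in> sets borel" "B \<in> sets borel" for A B
  proof -
    have "emeasure ?XY (A \<times> B) = (\<integral>\<^sup>+x. indicator (A \<times> B) x \<partial>?XY)"
      by simp
    also have "\<dots> = (\<integral>\<^sup>+\<omega>. indicator A (?X \<omega>) * indicator B (?Y \<omega>) \<partial>M)"
      by (subst nn_integral_distr) (auto simp: indicator_times)
    also have "\<dots> = (\<integral>\<^sup>+(z, w). indicator A (f z) * indicator B (g z w) \<partial>(distr M S Z \<Otimes>\<^sub>M distr M T W))"
      unfolding joint by (subst nn_integral_distr) auto
    also have "\<dots> = (\<integral>\<^sup>+z. \<integral>\<^sup>+w. indicator A (f z) * indicator B (g z w) \<partial>distr M T W \<partial>distr M S Z)"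
      by (subst W.nn_integral_fst[symmetric]) auto
    also have "\<dots> = (\<integral>\<^sup>+z. emeasure \<mu> B * indicator A (f z) \<partial>distr M S Z)"
    proof (rule nn_integral_cong_AE)
      show "AE z in distr M S Z. (\<integral>\<^sup>+w. indicator A (f z) * indicator B (g z w) \<partial>distr M T W)
          = emeasure \<mu> B * indicator A (f z)"
        using law AE_space[of "distr M S Z"]
      proof eventually_elim
        case (elim z)
        then have "z \<in> space S" by simp
        then have [measurable]: "g z \<in> borel_measurable T"
          using measurable_compose[OF measurable_Pair1' g] by simp
        have "emeasure \<mu> B = (\<integral>\<^sup>+r. indicator B r \<partial>distr (distr M T W) borel (g z))"
          using elim(1) by (simp add: sets_\<mu>)
        also have "\<dots> = (\<integral>\<^sup>+w. indicator B (g z w) \<partial>distr M T W)"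
          by (subst nn_integral_distr) auto
        finally show ?case by (simp add: nn_integral_cmult mult.commute)
      qed
    qed
    also have "\<dots> = emeasure \<mu> B * (\<integral>\<^sup>+z. indicator A (f z) \<partial>distr M S Z)"
      by (rule nn_integral_cmult) measurable
    also have "(\<integral>\<^sup>+z. indicator A (f z) \<partial>distr M S Z) = (\<integral>\<^sup>+r. indicator A r \<partial>distr M borel ?X)"
      by (simp add: nn_integral_distr del: nn_integral_indicator)
    also have "\<dots> = emeasure (distr M borel ?X) A"
      by (rule nn_integral_indicator) simp
    finally show ?thesis by (simp only: mult.commute)
  qed
  show eq: "distr M borel ?Y = \<mu>"
  proof (rule measure_eqI)
    fix B assume "B \<in> sets (distr M borel ?Y)"
    then have [measurable]: "B \<in> sets borel" by simp
    have "emeasure (distr M borel ?Y) B = emeasure ?XY (UNIV \<times> B)"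
      by (subst (1 2) emeasure_distr) (auto intro!: arg_cong[where f="emeasure M"])
    then show "emeasure (distr M borel ?Y) B = emeasure \<mu> B"
      using X.emeasure_space_1 by (simp add: rect)
  qed (simp add: sets_\<mu>)
  have "distr M borel ?X \<Otimes>\<^sub>M distr M borel ?Y = ?XY"
    unfolding eq
  proof (rule pair_measure_eqI)
    show "sets (distr M borel ?X \<Otimes>\<^sub>M \<mu>) = sets ?XY"
      by (simp add: sets_\<mu> cong: sets_pair_measure_cong)
  qed (simp_all add: rect sets_\<mu> X.sigma_finite_measure_axioms Y.sigma_finite_measure_axioms[unfolded eq])
  then show "indep_var borel ?X borel ?Y"
    by (simp add: indep_var_distribution_eq)
qed

context prob_space
begin

text \<open>
  Here \<open>Y l\<close> is independent of the family of \<open>Y i\<close>, \<open>Y j\<close> and \<open>Y k\<close>; given that family, the cosine of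
  \<open>Y k\<close> and \<open>Y l\<close> has the law found for the uniform ball. The indices \<open>i\<close>, \<open>j\<close>, \<open>k\<close> may coincide.
\<close>
lemma cos_on_law_and_independence:
  fixes Y :: "nat \<Rightarrow> 'a \<Rightarrow> 'b::euclidean_space"
  assumes ind: "indep_vars (\<lambda>_. borel) Y L"
    and law: "\<And>i. i \<in> L \<Longrightarrow> distr M borel (Y i) = D"
    and D: "rotation_invariant D" "prob_space D" "AE x in D. x \<noteq> 0"
    and B: "B \<subseteq> Basis" "2 \<le> card B"
    and ijkl: "{i, j, k, l} \<subseteq> L" "l \<notin> {i, j, k}"
  defines "c \<equiv> (real (card B) - 3) / 2"
  shows "distr M borel (\<lambda>\<omega>. cos_on B (Y k \<omega>) (Y l \<omega>)) =
      density lborel (\<lambda>t. ennreal (Gamma (c + 3/2) / (sqrt pi * Gamma (c + 1)) * symmetric_beta c t))"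
      (is "_ = ?\<mu>")
    and "indep_var borel (\<lambda>\<omega>. cos_on B (Y i \<omega>) (Y j \<omega>)) borel (\<lambda>\<omega>. cos_on B (Y k \<omega>) (Y l \<omega>))"
proof -
  obtain b where b: "b \<in> B" using B(2) by fastforce
  have [measurable]: "Y m \<in> borel_measurable M" if "m \<in> L" for m
    using ind that by (auto simp: indep_vars_def)
  have bB: "b \<in> Basis" "b \<noteq> 0" using b B(1) by auto
  have proj: "coord_proj B x \<noteq> 0" if "b \<bullet> x \<noteq> 0" for x
    using that coord_proj_inner_Basis[OF B(1) bB(1), of x] b by (auto simp: inner_commute)
  have AE_D: "AE x in D. coord_proj B x \<noteq> 0"
    using rotation_invariant_AE_inner[OF D bB(2)] by (rule eventually_mono) (rule proj)
  have AE_U: "AE x in uniform_ball. coord_proj B x \<noteq> 0"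
    using AE_uniform_ball_inner[OF bB(2)] by (rule eventually_mono) (rule proj)
  have \<mu>: "distr D borel (cos_on B x) = ?\<mu>" if "coord_proj B x \<noteq> 0" for x
    using distr_cos_on_eq[OF D(1) B(1) b that]
      distr_cos_on_unique[OF D(1,2) AE_D rotation_invariant_uniform_ball prob_space_uniform_ball AE_U B(1) b]
      distr_cos_on_uniform_ball[OF B(1) b B(2)]
    by (simp add: c_def)
  let ?K = "{i, j, k}"
  let ?S = "PiM ?K (\<lambda>_. borel :: 'b measure)"
  let ?Z = "\<lambda>\<omega>. restrict (\<lambda>m. Y m \<omega>) ?K"
  have L: "i \<in> L" "j \<in> L" "k \<in> L" "l \<in> L" using ijkl(1) by auto
  let ?T = "PiM {l} (\<lambda>_. borel :: 'b measure)"
  let ?W = "\<lambda>\<omega>. restrict (\<lambda>m. Y m \<omega>) {l}"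
  have ZW: "indep_var ?S ?Z ?T ?W"
    using ijkl by (intro indep_var_restrict[OF ind]) auto
  have [measurable]: "?Z \<in> M \<rightarrow>\<^sub>M ?S" "?W \<in> M \<rightarrow>\<^sub>M ?T" using L by (auto intro!: measurable_restrict)
  have "AE \<omega> in M. coord_proj B (Y k \<omega>) \<noteq> 0"
    using AE_D unfolding law[OF L(3), symmetric] by (subst (asm) AE_distr_iff) (use L in auto)
  then have "AE z in distr M ?S ?Z. coord_proj B (z k) \<noteq> 0"
    by (subst AE_distr_iff) auto
  moreover have "distr (distr M ?T ?W) borel (\<lambda>w. cos_on B x (w l)) = distr D borel (cos_on B x)" for x
    unfolding law[OF L(4), symmetric] using L by (simp add: distr_distr comp_def)
  ultimately have cond: "AE z in distr M ?S ?Z. distr (distr M ?T ?W) borel (\<lambda>w. cos_on B (z k) (w l)) = ?\<mu>"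
    by (auto elim!: eventually_mono simp: \<mu>)
  have meas: "(\<lambda>z. cos_on B (z i) (z j)) \<in> borel_measurable ?S"
    "(\<lambda>(z, w). cos_on B (z k) (w l)) \<in> borel_measurable (?S \<Otimes>\<^sub>M ?T)"
    by measurable
  show "distr M borel (\<lambda>\<omega>. cos_on B (Y k \<omega>) (Y l \<omega>)) = ?\<mu>"
    using indep_var_constant_conditional_law(1)[OF ZW meas cond] by simp
  show "indep_var borel (\<lambda>\<omega>. cos_on B (Y i \<omega>) (Y j \<omega>)) borel (\<lambda>\<omega>. cos_on B (Y k \<omega>) (Y l \<omega>))"
    using indep_var_constant_conditional_law(2)[OF ZW meas cond] by simp
qed

lemma pairwise_indep_cos_on:
  fixes Y :: "nat \<Rightarrow> 'a \<Rightarrow> 'b::euclidean_space"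
  assumes "indep_vars (\<lambda>_. borel) Y {1..p}"
    and "\<And>i. i \<in> {1..p} \<Longrightarrow> distr M borel (Y i) = D"
    and "rotation_invariant D" "prob_space D" "AE x in D. x \<noteq> 0"
    and "B \<subseteq> Basis" "2 \<le> card B"
  shows "pairwise (\<lambda>(i, j) (k, l). indep_var borel (\<lambda>\<omega>. cos_on B (Y i \<omega>) (Y j \<omega>))
      borel (\<lambda>\<omega>. cos_on B (Y k \<omega>) (Y l \<omega>))) {(i, j). 1 \<le> i \<and> i < j \<and> j \<le> p}"
proof (rule pairwiseI)
  fix x y
  assume "x \<in> {(i, j). 1 \<le> i \<and> i < j \<and> j \<le> p}" "y \<in> {(i, j). 1 \<le> i \<and> i < j \<and> j \<le> p}" "x \<noteq> y"
  then obtain i j k l where xy: "x = (i, j)" "y = (k, l)" and ij: "1 \<le> i" "i < j" "j \<le> p"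
      and kl: "1 \<le> k" "k < l" "l \<le> p" and ne: "(i, j) \<noteq> (k, l)"
    by auto
  note * = cos_on_law_and_independence(2)[OF assms]
  have "indep_var borel (\<lambda>\<omega>. cos_on B (Y i \<omega>) (Y j \<omega>)) borel (\<lambda>\<omega>. cos_on B (Y k \<omega>) (Y l \<omega>))"
  \<comment> \<open>One of \<open>k\<close>, \<open>l\<close> is missing from \<open>{i, j}\<close>: if both occurred, then \<open>k < l\<close> would force the pairs to be equal.\<close>
  proof (cases "l \<in> {i, j}")
    case False
    with ij kl show ?thesis by (intro *) auto
  next
    case True
    with ij kl ne have "indep_var borel (\<lambda>\<omega>. cos_on B (Y i \<omega>) (Y j \<omega>)) borel (\<lambda>\<omega>. cos_on B (Y l \<omega>) (Y k \<omega>))"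
      by (intro *) auto
    then show ?thesis by (simp add: cos_on_commute)
  qed
  then show "(\<lambda>(i, j) (k, l). indep_var borel (\<lambda>\<omega>. cos_on B (Y i \<omega>) (Y j \<omega>))
      borel (\<lambda>\<omega>. cos_on B (Y k \<omega>) (Y l \<omega>))) x y"
    by (simp add: xy)
qed

lemma distributed_cos_on:
  fixes Y :: "nat \<Rightarrow> 'a \<Rightarrow> 'b::euclidean_space"
  assumes ind: "indep_vars (\<lambda>_. borel) Y {1..p}"
    and law: "\<And>i. i \<in> {1..p} \<Longrightarrow> distr M borel (Y i) = D"
    and D: "rotation_invariant D" "prob_space D" "AE x in D. x \<noteq> 0"
    and B: "B \<subseteq> Basis" "card B = m" "2 \<le> m" and ij: "1 \<le> i \<and> i < j \<and> j \<le> p"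
  shows "distributed M lborel (\<lambda>\<omega>. cos_on B (Y i \<omega>) (Y j \<omega>))
         (\<lambda>r::real. ennreal (if \<bar>r\<bar> < 1 then
            1 / sqrt pi * (Gamma (real m / 2) / Gamma ((real m - 1) / 2))
              * (1 - r\<^sup>2) powr ((real m - 3) / 2) else 0))"
proof -
  have "Y l \<in> borel_measurable M" if "l \<in> {1..p}" for l
    using ind that by (auto simp: indep_vars_def)
  then have [measurable]: "Y i \<in> borel_measurable M" "Y j \<in> borel_measurable M" using ij by auto
  have e: "(real m - 3) / 2 + 3/2 = real m / 2" "(real m - 3) / 2 + 1 = (real m - 1) / 2"
    by (simp_all add: field_simps)
  have "distr M borel (\<lambda>\<omega>. cos_on B (Y i \<omega>) (Y j \<omega>)) = density lborel (\<lambda>t. ennreal (Gamma (real m / 2) / (sqrt pi * Gamma ((real m - 1) / 2)) * symmetric_beta ((real m - 3) / 2) t))"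
    using cos_on_law_and_independence(1)[OF ind law D B(1), of i i i j] ij B(2,3) by (simp add: e)
  moreover have "(\<lambda>t. ennreal (Gamma (real m / 2) / (sqrt pi * Gamma ((real m - 1) / 2)) * symmetric_beta ((real m - 3) / 2) t))
    = (\<lambda>r::real. ennreal (if \<bar>r\<bar> < 1 then
            1 / sqrt pi * (Gamma (real m / 2) / Gamma ((real m - 1) / 2))
              * (1 - r\<^sup>2) powr ((real m - 3) / 2) else 0))"
    by (auto simp: symmetric_beta_def fun_eq_iff)
  moreover have "distr M borel (\<lambda>\<omega>. cos_on B (Y i \<omega>) (Y j \<omega>)) = distr M lborel (\<lambda>\<omega>. cos_on B (Y i \<omega>) (Y j \<omega>))"
    by (rule distr_cong) simp_all
  ultimately show ?thesis
    unfolding distributed_def by simp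
qed

end

section \<open>Correlation coefficients as cosines\<close>

lemma spherical_rotation_invariant:
  assumes "spherical M Y"
  shows "rotation_invariant (distr M borel Y)"
  unfolding rotation_invariant_def
proof (intro conjI allI impI)
  fix T :: "real ^ 'b \<Rightarrow> real ^ 'b" assume T: "orthogonal_transformation T"
  have [measurable]: "Y \<in> borel_measurable M" "T \<in> borel \<rightarrow>\<^sub>M borel"
    using assms measurable_orthogonal_transformation[OF T] by (auto simp: spherical_def)
  have "orthogonal_matrix (matrix T)"
    using T by (simp add: orthogonal_transformation_matrix)
  with assms have "distr M borel (\<lambda>\<omega>. matrix T *v Y \<omega>) = distr M borel Y"
    unfolding spherical_def by blast
  moreover have "(\<lambda>\<omega>. matrix T *v Y \<omega>) = T \<circ> Y"
    using T by (auto simp: matrix_works orthogonal_transformation_linear)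
  ultimately show "distr (distr M borel Y) borel T = distr M borel Y"
    by (simp add: distr_distr)
qed simp

lemma pearson_uncentred_eq_cos_on: "pearson_uncentred x y = cos_on Basis x y"
  by (simp add: pearson_uncentred_def cos_on_def coord_proj_def euclidean_representation)

text \<open>
  With the unit vector \<open>u = (1, ..., 1) / sqrt n\<close>, centring is \<open>C x = x - (u \<bullet> x) *\<^sub>R u\<close>. If \<open>T\<close> maps \<open>u\<close> to
  the basis vector \<open>e\<close>, then \<open>T (C x) = T x - (T x \<bullet> e) *\<^sub>R e\<close>, which is \<open>T x\<close> with one coordinate deleted.
\<close>
lemma pearson_eq_cos_on:
  fixes k :: "'n::finite"
  obtains T :: "real ^ 'n \<Rightarrow> real ^ 'n" where "orthogonal_transformation T"
    and "\<And>x y :: real ^ 'n. pearson x y = cos_on (Basis - {axis k 1}) (T x) (T y)"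
proof
  let ?n = "real CARD('n)" and ?e = "axis k 1 :: real ^ 'n"
  define u :: "real ^ 'n" where "u = (\<chi> i. 1 / sqrt ?n)"
  define T where "T = reflect (u - ?e)"
  have n: "?n > 0" by simp
  show T: "orthogonal_transformation T"
    by (simp add: T_def orthogonal_transformation_reflect)
  have "u \<bullet> u = 1" using n by (simp add: u_def inner_vec_def)
  then have Tu: "T u = ?e"
    unfolding T_def by (intro reflect_swap) (simp add: norm_eq_1[THEN iffD2])
  define C where "C = (\<lambda>x. x - (u \<bullet> x) *\<^sub>R u)"
  have mean: "coord_mean x = (u \<bullet> x) * (1 / sqrt ?n)" for x :: "real ^ 'n"
  proof -
    have "u \<bullet> x = (1 / sqrt ?n) * (\<Sum>i\<in>UNIV. x $ i)"
      by (simp add: u_def inner_vec_def sum_distrib_left)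
    then show ?thesis by (simp add: coord_mean_def)
  qed
  have C: "C x $ i = x $ i - coord_mean x" for x i
    by (simp add: C_def mean) (simp add: u_def)
  have pearson: "pearson x y = (C x \<bullet> C y) / (norm (C x) * norm (C y))" for x y
    by (simp add: pearson_def C[symmetric] norm_eq_sqrt_inner inner_vec_def real_sqrt_mult power2_eq_square)
  have proj: "coord_proj (Basis - {?e}) (T x) = T (C x)" for x
  proof -
    have "(\<Sum>b\<in>Basis. (T x \<bullet> b) *\<^sub>R b) = T x" by (rule euclidean_representation)
    moreover have "(\<Sum>b\<in>Basis. (T x \<bullet> b) *\<^sub>R b) = (T x \<bullet> ?e) *\<^sub>R ?e + coord_proj (Basis - {?e}) (T x)"
      unfolding coord_proj_def by (rule sum.remove) (auto simp: axis_in_Basis_iff)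
    moreover have "T x \<bullet> ?e = u \<bullet> x"
      using T Tu by (metis orthogonal_transformation_def inner_commute)
    ultimately have "coord_proj (Basis - {?e}) (T x) = T x - (u \<bullet> x) *\<^sub>R T u"
      by (simp add: Tu algebra_simps)
    then show ?thesis
      using orthogonal_transformation_linear[OF T] by (simp add: C_def linear_diff linear_cmul)
  qed
  show "pearson x y = cos_on (Basis - {?e}) (T x) (T y)" for x y :: "real ^ 'n"
    using T by (simp add: pearson cos_on_def proj orthogonal_transformation_norm) (simp add: orthogonal_transformation_def)
qed

theorem lemma4p1:
  fixes M :: "'w measure"
    and X :: "nat \<Rightarrow> 'w \<Rightarrow> real ^ 'n"
    and p :: nat
  assumes "prob_space M"
    and "CARD('n) \<ge> 3"
    and "prob_space.indep_vars M (\<lambda>_. borel) X {1..p}"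
    and "\<And>i. i \<in> {1..p} \<Longrightarrow> distr M borel (X i) = distr M borel (X 1)"
    and "spherical M (X 1)"
    and "measure M {\<omega> \<in> space M. X 1 \<omega> = 0} = 0"
  shows
    "(pairwise (\<lambda>(i, j) (k, l).
        prob_space.indep_var M borel (\<lambda>\<omega>. pearson (X i \<omega>) (X j \<omega>))
                               borel (\<lambda>\<omega>. pearson (X k \<omega>) (X l \<omega>)))
       {(i, j). 1 \<le> i \<and> i < j \<and> j \<le> p}) \<and>
     (\<forall>i j. 1 \<le> i \<and> i < j \<and> j \<le> p \<longrightarrow>
       distributed M lborel (\<lambda>\<omega>. pearson (X i \<omega>) (X j \<omega>))
         (\<lambda>r::real. ennreal (if \<bar>r\<bar> < 1 then
            1 / sqrt pi * (Gamma ((real CARD('n) - 1) / 2) / Gamma ((real CARD('n) - 2) / 2))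
              * (1 - r\<^sup>2) powr ((real CARD('n) - 4) / 2) else 0))) \<and>
     (pairwise (\<lambda>(i, j) (k, l).
        prob_space.indep_var M borel (\<lambda>\<omega>. pearson_uncentred (X i \<omega>) (X j \<omega>))
                               borel (\<lambda>\<omega>. pearson_uncentred (X k \<omega>) (X l \<omega>)))
       {(i, j). 1 \<le> i \<and> i < j \<and> j \<le> p}) \<and>
     (\<forall>i j. 1 \<le> i \<and> i < j \<and> j \<le> p \<longrightarrow>
       distributed M lborel (\<lambda>\<omega>. pearson_uncentred (X i \<omega>) (X j \<omega>))
         (\<lambda>r::real. ennreal (if \<bar>r\<bar> < 1 then
            1 / sqrt pi * (Gamma (real CARD('n) / 2) / Gamma ((real CARD('n) - 1) / 2))
              * (1 - r\<^sup>2) powr ((real CARD('n) - 3) / 2) else 0)))"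
proof -
  interpret prob_space M by fact
  define D where "D = distr M borel (X 1)"
  have X1 [measurable]: "X 1 \<in> borel_measurable M"
    using assms(5) by (simp add: spherical_def)
  have law: "distr M borel (X i) = D" if "i \<in> {1..p}" for i
    using assms(4)[OF that] by (simp add: D_def)
  have rot: "rotation_invariant D"
    unfolding D_def by (rule spherical_rotation_invariant) fact
  have prob: "prob_space D"
    unfolding D_def by (rule prob_space_distr) fact
  have "AE \<omega> in M. X 1 \<omega> \<noteq> 0"
  proof (subst AE_iff_measurable[OF _ refl])
    have "{\<omega> \<in> space M. \<not> X 1 \<omega> \<noteq> 0} = X 1 -` {0} \<inter> space M" by auto
    also have "\<dots> \<in> sets M" by measurable
    finally show "{\<omega> \<in> space M. \<not> X 1 \<omega> \<noteq> 0} \<in> sets M" .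
  qed (use assms(6) in \<open>simp add: emeasure_eq_measure\<close>)
  then have nz: "AE x in D. x \<noteq> 0"
    unfolding D_def using X1 by (subst AE_distr_iff) simp_all
  obtain k :: 'n where True by simp
  let ?e = "axis k 1 :: real ^ 'n"
  have e: "?e \<in> Basis" by (auto simp: axis_in_Basis_iff)
  obtain T :: "real ^ 'n \<Rightarrow> real ^ 'n" where T: "orthogonal_transformation T"
    and pearson: "\<And>x y :: real ^ 'n. pearson x y = cos_on (Basis - {?e}) (T x) (T y)"
    using pearson_eq_cos_on[of k] by blast
  note [measurable] = measurable_orthogonal_transformation[OF T]
  have indT: "indep_vars (\<lambda>_. borel) (\<lambda>i \<omega>. T (X i \<omega>)) {1..p}"
    using assms(3) by (rule indep_vars_compose2) measurable
  have lawT: "distr M borel (\<lambda>\<omega>. T (X i \<omega>)) = D" if "i \<in> {1..p}" for i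
  proof -
    have [measurable]: "X i \<in> borel_measurable M"
      using assms(3) that by (auto simp: indep_vars_def)
    have "distr M borel (\<lambda>\<omega>. T (X i \<omega>)) = distr (distr M borel (X i)) borel T"
      by (simp add: distr_distr comp_def)
    then show ?thesis by (simp add: law[OF that] rotation_invariant_distr[OF rot T])
  qed
  have card: "card (Basis - {?e}) = CARD('n) - 1" "card (Basis :: (real ^ 'n) set) = CARD('n)"
    using e by simp_all
  have r: "real (CARD('n) - 1) = real CARD('n) - 1" using assms(2) by linarith
  have r': "real CARD('n) - 1 - 1 = real CARD('n) - 2" "real CARD('n) - 1 - 3 = real CARD('n) - 4"
    by simp_all
  show ?thesis
  proof (intro conjI allI impI)
    show "pairwise (\<lambda>(i, j) (k, l). indep_var borel (\<lambda>\<omega>. pearson (X i \<omega>) (X j \<omega>))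
        borel (\<lambda>\<omega>. pearson (X k \<omega>) (X l \<omega>))) {(i, j). 1 \<le> i \<and> i < j \<and> j \<le> p}"
      unfolding pearson using assms(2) by (intro pairwise_indep_cos_on[OF indT lawT rot prob nz]) (auto simp: card)
    show "pairwise (\<lambda>(i, j) (k, l). indep_var borel (\<lambda>\<omega>. pearson_uncentred (X i \<omega>) (X j \<omega>))
        borel (\<lambda>\<omega>. pearson_uncentred (X k \<omega>) (X l \<omega>))) {(i, j). 1 \<le> i \<and> i < j \<and> j \<le> p}"
      unfolding pearson_uncentred_eq_cos_on using assms(2)
      by (intro pairwise_indep_cos_on[OF assms(3) law rot prob nz]) (auto simp: card)
    fix i j assume ij: "1 \<le> i \<and> i < j \<and> j \<le> p"
    show "distributed M lborel (\<lambda>\<omega>. pearson (X i \<omega>) (X j \<omega>))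
         (\<lambda>r::real. ennreal (if \<bar>r\<bar> < 1 then
            1 / sqrt pi * (Gamma ((real CARD('n) - 1) / 2) / Gamma ((real CARD('n) - 2) / 2))
              * (1 - r\<^sup>2) powr ((real CARD('n) - 4) / 2) else 0))"
      using distributed_cos_on[OF indT lawT rot prob nz Diff_subset card(1) _ ij] assms(2)
      unfolding pearson r r' by simp
    show "distributed M lborel (\<lambda>\<omega>. pearson_uncentred (X i \<omega>) (X j \<omega>))
         (\<lambda>r::real. ennreal (if \<bar>r\<bar> < 1 then
            1 / sqrt pi * (Gamma (real CARD('n) / 2) / Gamma ((real CARD('n) - 1) / 2))
              * (1 - r\<^sup>2) powr ((real CARD('n) - 3) / 2) else 0))"
      unfolding pearson_uncentred_eq_cos_on using assms(2)
      by (intro distributed_cos_on[OF assms(3) law rot prob nz order_refl card(2) _ ij]) auto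
  qed
qed

end
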